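(* Let $L_{eq}=\{a^nb^n\mid n\ge 0\}\subseteq\{a,b\}^*$. For every $\epsilon\in(0,\frac12)$ there exists a two-way quantum finite automaton with reset with $O(\log(\frac1\epsilon))$ states that recognizes $L_{eq}$ with one-sided error bound $\epsilon$ in $O(\log(\frac1\epsilon)|w|)$ steps, where $w$ is the input string.
   Context: Let $\vdash,\dashv$ be end-markers, $\Sigma=\{a,b\}$, $\Gamma=\Sigma\cup\{\vdash,\dashv\}$. A two-way quantum finite automaton with reset consists of a finite state set $Q$ partitioned into $Q_{non}$ (nonhalting), $Q_{acc}$, $Q_{rej}$, $Q_{reset}$, where $Q_{reset}$ is a disjoint union of sets $Q^{\curvearrowleft}_q$ indexed by $q\in Q_{non}$; an initial state $q_0\in Q_{non}$; and a transition function $\delta:Q\times\Gamma\times Q\times\{-1,0,1\}\to\mathbb{C}$. On input $w$ let $x=\vdash w\dashv=x_0\cdots x_{N-1}$, $N=|w|+2$; configurations are pairs $(q,i)\in Q\times\mathbb{Z}_N$, and for every $w$ the operator $U^w|q,i\rangle=\sum_{q',d}\delta(q,x_i,q',d)|q',i+d\bmod N\rangle$ on $\ell_2(Q\times\mathbb{Z}_N)$ must be unitary. The computation starts in $|q_0,0\rangle$; each step applies $U^w$ and then performs the projective measurement onto the spans of the configurations whose state lies in $Q_{acc}$, $Q_{rej}$, $Q_{non}$, and $Q^{\curvearrowleft}_q$ for each $q\in Q_{non}$: "accept"/"reject" halt with that answer; "nonhalting" continues from the normalized projection onto the nonhalting configurations; "reset with $q$" (outcome for $Q^{\curvearrowleft}_q$)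 continues from $|q,0\rangle$. A machine recognizes $L$ with one-sided error bound $\epsilon$ if either it accepts every member of $L$ with probability 1 and rejects every nonmember with probability at least $1-\epsilon$, or it rejects every nonmember with probability 1 and accepts every member with probability at least $1-\epsilon$. *)

theory Defs
  imports Complex_Main "HOL-Library.Disjoint_Sets"
begin

datatype letter = La | Lb

datatype tape_symbol = LeftEnd | RightEnd | Letter letter

definition tape :: "letter list \<Rightarrow> tape_symbol list" where
  "tape w = LeftEnd # map Letter w @ [RightEnd]"

text \<open>\<open>Q_reset M q\<close> is the set of states whose observation resets the machine to \<open>q\<close>; only its
  values at nonhalting \<open>q\<close> matter. The transition function is likewise only consulted for states
  in \<open>states M\<close> and head movements in \<open>{-1, 0, 1}\<close>.\<close>

record 'q qfa_reset =
  Q_non :: "'q set"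
  Q_acc :: "'q set"
  Q_rej :: "'q set"
  Q_reset :: "'q \<Rightarrow> 'q set"
  init :: 'q
  delta :: "'q \<Rightarrow> tape_symbol \<Rightarrow> 'q \<Rightarrow> int \<Rightarrow> complex"

definition states :: "'q qfa_reset \<Rightarrow> 'q set" where
  "states M = Q_non M \<union> Q_acc M \<union> Q_rej M \<union> (\<Union>q\<in>Q_non M. Q_reset M q)"

text \<open>A superposition is a function assigning amplitudes to configurations; the elements of
  $\ell_2(Q \times Z_N)$ are represented by their values on \<open>configs M w\<close>.\<close>

type_synonym 'q config = "'q \<times> int"
type_synonym 'q superposition = "'q config \<Rightarrow> complex"

definition configs :: "'q qfa_reset \<Rightarrow> letter list \<Rightarrow> 'q config set" where
  "configs M w = states M \<times> {0..<int (length (tape w))}"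

definition ket :: "'q config \<Rightarrow> 'q superposition" where
  "ket c = (\<lambda>c'. if c' = c then 1 else 0)"

definition evol_ket :: "'q qfa_reset \<Rightarrow> letter list \<Rightarrow> 'q config \<Rightarrow> 'q superposition" where
  "evol_ket M w = (\<lambda>(q, i) c'.
     \<Sum>q'\<in>states M. \<Sum>d\<in>{-1, 0, 1}.
       delta M q (tape w ! nat i) q' d * ket (q', (i + d) mod int (length (tape w))) c')"

definition evol :: "'q qfa_reset \<Rightarrow> letter list \<Rightarrow> 'q superposition \<Rightarrow> 'q superposition" where
  "evol M w \<psi> = (\<lambda>c'. \<Sum>c\<in>configs M w. \<psi> c * evol_ket M w c c')"

text \<open>Here \<open>U c\<close> is the image of the basis vector \<open>c\<close>, that is, column \<open>c\<close> of the matrix. The two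
  conjuncts are $U^* U = I$ and $U U^* = I$.\<close>

definition unitary_on :: "'c set \<Rightarrow> ('c \<Rightarrow> 'c \<Rightarrow> complex) \<Rightarrow> bool" where
  "unitary_on S U \<longleftrightarrow>
     (\<forall>c\<in>S. \<forall>d\<in>S. (\<Sum>e\<in>S. cnj (U c e) * U d e) = (if c = d then 1 else 0)) \<and>
     (\<forall>c\<in>S. \<forall>d\<in>S. (\<Sum>e\<in>S. U e c * cnj (U e d)) = (if c = d then 1 else 0))"

definition qfa_reset_wf :: "'q qfa_reset \<Rightarrow> bool" where
  "qfa_reset_wf M \<longleftrightarrow>
     finite (states M) \<and>
     disjnt (Q_non M) (Q_acc M) \<and> disjnt (Q_non M) (Q_rej M) \<and> disjnt (Q_acc M) (Q_rej M) \<and>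
     disjnt (Q_non M \<union> Q_acc M \<union> Q_rej M) (\<Union>q\<in>Q_non M. Q_reset M q) \<and>
     disjoint_family_on (Q_reset M) (Q_non M) \<and>
     init M \<in> Q_non M \<and>
     (\<forall>w. unitary_on (configs M w) (evol_ket M w))"

definition proj :: "'q set \<Rightarrow> 'q superposition \<Rightarrow> 'q superposition" where
  "proj A \<psi> = (\<lambda>c. if fst c \<in> A then \<psi> c else 0)"

definition sq_norm :: "'q qfa_reset \<Rightarrow> letter list \<Rightarrow> 'q superposition \<Rightarrow> real" where
  "sq_norm M w \<psi> = (\<Sum>c\<in>configs M w. (cmod (\<psi> c))\<^sup>2)"

definition normalized :: "'q qfa_reset \<Rightarrow> letter list \<Rightarrow> 'q superposition \<Rightarrow> 'q superposition" where
  "normalized M w \<psi> = (\<lambda>c. \<psi> c / complex_of_real (sqrt (sq_norm M w \<psi>)))"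

text \<open>\<open>halt_prob M w H n \<psi>\<close>, for \<open>H\<close> the accepting or the rejecting states, is the probability that
  the computation continued from \<open>\<psi>\<close> halts within \<open>n\<close> steps with the answer belonging to \<open>H\<close>,
  computed by conditioning on the outcome of the first measurement. An outcome of probability 0
  contributes 0, although its normalized projection is then meaningless.\<close>

fun halt_prob ::
    "'q qfa_reset \<Rightarrow> letter list \<Rightarrow> 'q set \<Rightarrow> nat \<Rightarrow> 'q superposition \<Rightarrow> real" where
  "halt_prob M w H 0 \<psi> = 0"
| "halt_prob M w H (Suc n) \<psi> =
    (let \<phi> = evol M w \<psi>; \<phi>_non = proj (Q_non M) \<phi> in
       sq_norm M w (proj H \<phi>)
       + sq_norm M w \<phi>_non * halt_prob M w H n (normalized M w \<phi>_non)
       + (\<Sum>q\<in>Q_non M. sq_norm M w (proj (Q_reset M q) \<phi>) * halt_prob M w H n (ket (q, 0))))"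

definition accept_within :: "'q qfa_reset \<Rightarrow> letter list \<Rightarrow> nat \<Rightarrow> real" where
  "accept_within M w n = halt_prob M w (Q_acc M) n (ket (init M, 0))"

definition reject_within :: "'q qfa_reset \<Rightarrow> letter list \<Rightarrow> nat \<Rightarrow> real" where
  "reject_within M w n = halt_prob M w (Q_rej M) n (ket (init M, 0))"

definition accept_prob :: "'q qfa_reset \<Rightarrow> letter list \<Rightarrow> real" where
  "accept_prob M w = lim (accept_within M w)"

definition reject_prob :: "'q qfa_reset \<Rightarrow> letter list \<Rightarrow> real" where
  "reject_prob M w = lim (reject_within M w)"

definition recognizes_one_sided :: "'q qfa_reset \<Rightarrow> letter list set \<Rightarrow> real \<Rightarrow> bool" where
  "recognizes_one_sided M L \<epsilon> \<longleftrightarrow>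
     (\<forall>w\<in>L. accept_prob M w = 1) \<and> (\<forall>w. w \<notin> L \<longrightarrow> reject_prob M w \<ge> 1 - \<epsilon>) \<or>
     (\<forall>w. w \<notin> L \<longrightarrow> reject_prob M w = 1) \<and> (\<forall>w\<in>L. accept_prob M w \<ge> 1 - \<epsilon>)"

text \<open>Worst-case running time: with probability 1 the machine has halted after at most \<open>t\<close> steps,
  steps before and after resets being counted together.\<close>

definition halts_within :: "'q qfa_reset \<Rightarrow> letter list \<Rightarrow> nat \<Rightarrow> bool" where
  "halts_within M w t \<longleftrightarrow> accept_within M w t + reject_within M w t = 1"

definition L_eq :: "letter list set" where
  "L_eq = {replicate n La @ replicate n Lb | n. True}"

end

theory Submission
  imports Defs "HOL-Combinatorics.Permutations"
begin

text \<open>A constant-size machine first scans the input for the shape $a^n b^m$ and then, after a reset,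
  forks into two branches of equal amplitude: one pauses for one step on every $b$, the other on
  every $a$. They reach the right end-marker after $n + 2m$ and $2n + m$ steps. If $n = m$ the
  branches interfere there and a Hadamard transform leads to the state \<open>same\<close> with certainty;
  otherwise they are measured separately and each is rejected with probability $1/2$. Chaining
  $k = O(\log (1/\epsilon))$ copies by resets from \<open>same\<close> to the next copy, with the last \<open>same\<close>
  accepting, lowers the error to $2^{-k}$.\<close>

section \<open>Halting probabilities without normalization\<close>

text \<open>The slow branches compare only the numbers of a's and b's and would meet on every word
  with equally many of each; the order of the letters is enforced by the scan alone. Passing to a
  fresh copy instead of restarting makes the machine halt by a fixed time with certainty. All
  halting probabilities therefore become constant after a known number of steps, and the analysis
  computes these constants, backwards from the last copy, without estimates or limits. The obstacle
  is unitarity, which is demanded on the cyclic tape of every word and thus also on configurations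
  that no computation reaches. Letting the entered state fix the head movement reduces it to one 13
  by 13 matrix per tape symbol, composed of a permutation and at most one Hadamard
  transform.\<close>

text \<open>\<open>gain M w H n s\<close> is what a measurement that finds the machine in state \<open>s\<close> contributes to the
  halting probability, with \<open>n\<close> steps left; it vanishes for nonhalting \<open>s\<close>.\<close>

definition gain :: "'q qfa_reset \<Rightarrow> letter list \<Rightarrow> 'q set \<Rightarrow> nat \<Rightarrow> 'q \<Rightarrow> real" where
  "gain M w H n s = of_bool (s \<in> H)
     + (\<Sum>q\<in>Q_non M. of_bool (s \<in> Q_reset M q) * halt_prob M w H n (ket (q, 0)))"

lemma evol_cong:
  assumes "\<And>c. c \<in> configs M w \<Longrightarrow> \<psi> c = \<psi>' c"
  shows "evol M w \<psi> = evol M w \<psi>'"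
  unfolding evol_def using assms by (intro ext sum.cong) auto

lemma evol_scale: "evol M w (\<lambda>c. x * \<psi> c) = (\<lambda>c. x * evol M w \<psi> c)"
  unfolding evol_def by (simp add: sum_distrib_left mult.assoc)

lemma evol_add: "evol M w (\<lambda>c. \<psi> c + \<phi> c) = (\<lambda>c. evol M w \<psi> c + evol M w \<phi> c)"
  unfolding evol_def by (simp add: distrib_right sum.distrib)

lemma proj_scale: "proj A (\<lambda>c. x * \<psi> c) = (\<lambda>c. x * proj A \<psi> c)"
  by (auto simp: proj_def)

lemma sq_norm_scale: "sq_norm M w (\<lambda>c. x * \<psi> c) = (cmod x)\<^sup>2 * sq_norm M w \<psi>"
  unfolding sq_norm_def by (simp add: sum_distrib_left norm_mult power_mult_distrib)

lemma halt_prob_cong: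
  assumes "\<And>c. c \<in> configs M w \<Longrightarrow> \<psi> c = \<psi>' c"
  shows "halt_prob M w H n \<psi> = halt_prob M w H n \<psi>'"
  using evol_cong[OF assms, where w = w and M = M] by (cases n) auto

lemma halt_prob_zero: "halt_prob M w H n (\<lambda>c. 0) = 0"
  by (cases n) (auto simp: evol_def proj_def sq_norm_def Let_def intro!: sum.neutral)

lemma normalized_scale:
  assumes "x > 0"
  shows "normalized M w (\<lambda>c. complex_of_real x * \<psi> c) = normalized M w \<psi>"
  using assms
  by (simp add: normalized_def sq_norm_scale real_sqrt_mult)

lemma halt_prob_scale:
  assumes "x > 0"
  shows "halt_prob M w H n (\<lambda>c. complex_of_real x * \<psi> c) = x\<^sup>2 * halt_prob M w H n \<psi>"
  using assms
  by (cases n)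
    (simp_all add: evol_scale proj_scale sq_norm_scale normalized_scale Let_def distrib_left
      sum_distrib_left mult.assoc)

lemma sq_norm_eq_0:
  assumes "finite (states M)" "sq_norm M w \<psi> = 0" "c \<in> configs M w"
  shows "\<psi> c = 0"
proof -
  have "finite (configs M w)" using assms by (simp add: configs_def)
  then show ?thesis
    using assms unfolding sq_norm_def by (subst (asm) sum_nonneg_eq_0_iff) auto
qed

lemma sq_norm_nonneg: "sq_norm M w \<psi> \<ge> 0"
  unfolding sq_norm_def by (simp add: sum_nonneg)

text \<open>Homogeneity with the factor \<open>1 / sqrt (sq_norm M w \<psi>)\<close>. If the norm is
  0, the left side is 0 whatever \<open>normalized\<close> yields, and \<psi> vanishes on
  \<open>configs M w\<close>, the only place where its values are read.\<close>

lemma halt_prob_normalized: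
  assumes "finite (states M)"
  shows "sq_norm M w \<psi> * halt_prob M w H n (normalized M w \<psi>) = halt_prob M w H n \<psi>"
proof (cases "sq_norm M w \<psi> = 0")
  case True
  then have "halt_prob M w H n \<psi> = halt_prob M w H n (\<lambda>c. 0)"
    using assms by (intro halt_prob_cong) (auto intro: sq_norm_eq_0)
  with True show ?thesis by (simp add: halt_prob_zero)
next
  case False
  let ?r = "1 / sqrt (sq_norm M w \<psi>)"
  have pos: "sq_norm M w \<psi> > 0" using False sq_norm_nonneg[of M w \<psi>] by simp
  have "normalized M w \<psi> = (\<lambda>c. complex_of_real ?r * \<psi> c)"
    by (simp add: normalized_def)
  then have "halt_prob M w H n (normalized M w \<psi>) = ?r\<^sup>2 * halt_prob M w H n \<psi>"
    using halt_prob_scale[of ?r M w H n \<psi>] pos by simp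
  then show ?thesis using pos by (simp add: power_divide)
qed

lemma sq_norm_proj: "sq_norm M w (proj A \<phi>) = (\<Sum>c\<in>configs M w. (cmod (\<phi> c))\<^sup>2 * of_bool (fst c \<in> A))"
  unfolding sq_norm_def proj_def by (intro sum.cong) auto

text \<open>Since \<open>halt_prob\<close> is homogeneous of degree 2 in the superposition, the normalization can be
  dropped from its recursion.\<close>

lemma halt_prob_Suc:
  assumes "finite (states M)"
  shows "halt_prob M w H (Suc n) \<psi> = halt_prob M w H n (proj (Q_non M) (evol M w \<psi>))
     + (\<Sum>c\<in>configs M w. (cmod (evol M w \<psi> c))\<^sup>2 * gain M w H n (fst c))"
proof -
  let ?\<phi> = "evol M w \<psi>"
  have "(\<Sum>c\<in>configs M w. (cmod (?\<phi> c))\<^sup>2 * gain M w H n (fst c)) =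
    sq_norm M w (proj H ?\<phi>) +
    (\<Sum>c\<in>configs M w. \<Sum>q\<in>Q_non M. (cmod (?\<phi> c))\<^sup>2 *
      (of_bool (fst c \<in> Q_reset M q) * halt_prob M w H n (ket (q, 0))))"
    unfolding gain_def sq_norm_proj by (simp only: distrib_left sum.distrib sum_distrib_left)
  also have "(\<Sum>c\<in>configs M w. \<Sum>q\<in>Q_non M. (cmod (?\<phi> c))\<^sup>2 *
      (of_bool (fst c \<in> Q_reset M q) * halt_prob M w H n (ket (q, 0))))
    = (\<Sum>q\<in>Q_non M. sq_norm M w (proj (Q_reset M q) ?\<phi>) * halt_prob M w H n (ket (q, 0)))"
    unfolding sq_norm_proj by (subst sum.swap) (simp add: sum_distrib_right mult.assoc)
  finally show ?thesis
    using assms by (simp add: Let_def halt_prob_normalized)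
qed

section \<open>Exact outcomes of runs with at most two live configurations\<close>

text \<open>The nonhalting part of the machine's superposition never has more than two
  configurations, one per branch. A single configuration is the case \<open>c = d\<close>,
  \<open>\<beta> = 0\<close>.\<close>

definition superpose :: "complex \<Rightarrow> 'q config \<Rightarrow> complex \<Rightarrow> 'q config \<Rightarrow> 'q superposition" where
  "superpose \<alpha> c \<beta> d = (\<lambda>x. \<alpha> * ket c x + \<beta> * ket d x)"

lemma evol_ket_configs:
  assumes "finite (states M)" "c \<in> configs M w"
  shows "evol M w (ket c) = evol_ket M w c"
  using assms by (auto simp: evol_def ket_def configs_def if_distrib if_distribR cong: if_cong)

lemma evol_superpose:
  assumes "finite (states M)" "c \<in> configs M w" "d \<in> configs M w"
  shows "evol M w (superpose \<alpha> c \<beta> d) = (\<lambda>x. \<alpha> * evol_ket M w c x + \<beta> * evol_ket M w d x)"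
  using assms by (simp add: superpose_def evol_add evol_scale evol_ket_configs)

lemma superpose_single: "superpose 1 c 0 c = ket c"
  by (simp add: superpose_def)

text \<open>Values that are exact from time \<open>B\<close> on yield the limits and, when
  \<open>a + r = 1\<close>, also the worst-case running time.\<close>

definition outcome :: "'q qfa_reset \<Rightarrow> letter list \<Rightarrow> 'q superposition \<Rightarrow> real \<Rightarrow> real \<Rightarrow> nat \<Rightarrow> bool" where
  "outcome M w \<psi> a r B \<longleftrightarrow>
     (\<forall>n\<ge>B. halt_prob M w (Q_acc M) n \<psi> = a \<and> halt_prob M w (Q_rej M) n \<psi> = r)"

definition gains :: "'q qfa_reset \<Rightarrow> letter list \<Rightarrow> 'q \<Rightarrow> real \<Rightarrow> real \<Rightarrow> nat \<Rightarrow> bool" where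
  "gains M w s a r B \<longleftrightarrow>
     (\<forall>n\<ge>B. gain M w (Q_acc M) n s = a \<and> gain M w (Q_rej M) n s = r)"

lemma outcome_mono: "outcome M w \<psi> a r B \<Longrightarrow> B \<le> B' \<Longrightarrow> outcome M w \<psi> a r B'"
  by (auto simp: outcome_def)

lemma gains_mono: "gains M w s a r B \<Longrightarrow> B \<le> B' \<Longrightarrow> gains M w s a r B'"
  by (auto simp: gains_def)

lemma outcome_zero: "outcome M w (\<lambda>c. 0) 0 0 0"
  by (simp add: outcome_def halt_prob_zero)

text \<open>As \<open>F\<close> contains the support of \<phi>, the sum over all configurations
  shrinks to a few explicit terms. One bound \<open>B\<close> serves the continuation and all
  measured states; the step itself adds 1.\<close>

lemma outcome_step:
  assumes "finite (states M)"
    and "evol M w \<psi> = \<phi>"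
    and non: "outcome M w (proj (Q_non M) \<phi>) a r B"
    and F: "F \<subseteq> configs M w" "\<And>c. c \<in> configs M w - F \<Longrightarrow> \<phi> c = 0"
    and g: "\<And>c. c \<in> F \<Longrightarrow> gains M w (fst c) (ga c) (gr c) B"
  shows "outcome M w \<psi> (a + (\<Sum>c\<in>F. (cmod (\<phi> c))\<^sup>2 * ga c))
    (r + (\<Sum>c\<in>F. (cmod (\<phi> c))\<^sup>2 * gr c)) (Suc B)"
  unfolding outcome_def
proof (intro allI impI)
  fix n assume "Suc B \<le> n"
  then obtain n' where n': "n = Suc n'" "B \<le> n'" by (cases n) auto
  have fin: "finite (configs M w)" using assms(1) by (simp add: configs_def)
  have "(\<Sum>c\<in>configs M w. (cmod (\<phi> c))\<^sup>2 * f c) = (\<Sum>c\<in>F. (cmod (\<phi> c))\<^sup>2 * f c)" for f :: "_ \<Rightarrow> real"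
    using F fin by (intro sum.mono_neutral_right) auto
  then show "halt_prob M w (Q_acc M) n \<psi> = a + (\<Sum>c\<in>F. (cmod (\<phi> c))\<^sup>2 * ga c) \<and>
     halt_prob M w (Q_rej M) n \<psi> = r + (\<Sum>c\<in>F. (cmod (\<phi> c))\<^sup>2 * gr c)"
    using non g n'(2) unfolding n'(1)
    by (auto simp: halt_prob_Suc[OF assms(1)] assms(2) outcome_def gains_def simp del: halt_prob.simps
        intro!: sum.cong)
qed

lemma gains_not_reset:
  assumes "qfa_reset_wf M" "s \<in> Q_non M \<union> Q_acc M \<union> Q_rej M"
  shows "gains M w s (of_bool (s \<in> Q_acc M)) (of_bool (s \<in> Q_rej M)) 0"
proof -
  have "s \<notin> Q_reset M q" if "q \<in> Q_non M" for q
    using assms that unfolding qfa_reset_wf_def disjnt_def by blast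
  then show ?thesis by (simp add: gains_def gain_def)
qed

lemma wf_disjoint:
  assumes "qfa_reset_wf M"
  shows "s \<in> Q_non M \<Longrightarrow> s \<notin> Q_acc M" "s \<in> Q_non M \<Longrightarrow> s \<notin> Q_rej M"
    "s \<in> Q_acc M \<Longrightarrow> s \<notin> Q_rej M"
  using assms by (auto simp: qfa_reset_wf_def disjnt_iff)

lemma gains_nonhalting: "qfa_reset_wf M \<Longrightarrow> s \<in> Q_non M \<Longrightarrow> gains M w s 0 0 0"
  and gains_accept: "qfa_reset_wf M \<Longrightarrow> s \<in> Q_acc M \<Longrightarrow> gains M w s 1 0 0"
  and gains_reject: "qfa_reset_wf M \<Longrightarrow> s \<in> Q_rej M \<Longrightarrow> gains M w s 0 1 0"
  using gains_not_reset[of M s w] wf_disjoint[of M s] by fastforce+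

text \<open>Disjointness of the reset sets leaves only the term \<open>q = p\<close> of
  \<open>gain\<close>. The bound stays \<open>B\<close> because the step leading to the measurement
  is counted in \<open>outcome_step\<close>.\<close>

lemma gains_reset:
  assumes wf: "qfa_reset_wf M" and "p \<in> Q_non M" "s \<in> Q_reset M p"
    and out: "outcome M w (ket (p, 0)) a r B"
  shows "gains M w s a r B"
proof -
  have fin: "finite (Q_non M)"
    using wf by (auto simp: qfa_reset_wf_def states_def)
  have *: "s \<in> Q_reset M q \<longleftrightarrow> q = p" if "q \<in> Q_non M" for q
    using wf that assms(2,3) by (auto simp: qfa_reset_wf_def disjoint_family_on_def)
  have "s \<notin> Q_acc M" "s \<notin> Q_rej M"
    using wf assms(2,3) by (auto simp: qfa_reset_wf_def disjnt_def)
  moreover have "(\<Sum>q\<in>Q_non M. of_bool (s \<in> Q_reset M q) * f q) = f p" for f :: "_ \<Rightarrow> real"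
  proof -
    have "(\<Sum>q\<in>Q_non M. of_bool (s \<in> Q_reset M q) * f q) = (\<Sum>q\<in>Q_non M. if q = p then f q else 0)"
      by (intro sum.cong) (auto simp: *)
    then show ?thesis using fin assms(2) by simp
  qed
  ultimately show ?thesis
    using out by (simp add: gains_def gain_def outcome_def)
qed

definition moves :: "'q qfa_reset \<Rightarrow> letter list \<Rightarrow> ('q config \<times> 'q config) set" where
  "moves M w = {(c, c'). c \<in> configs M w \<and> c' \<in> configs M w \<and> fst c' \<in> Q_non M \<and>
     evol_ket M w c = ket c'}"

lemma proj_superpose:
  "fst c \<in> A \<Longrightarrow> fst d \<in> A \<Longrightarrow> proj A (superpose \<alpha> c \<beta> d) = superpose \<alpha> c \<beta> d"
  by (auto simp: proj_def superpose_def ket_def fun_eq_iff)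

lemma outcome_nonhalting:
  assumes wf: "qfa_reset_wf M"
    and "evol M w \<psi> = superpose \<alpha> c \<beta> d" "c \<in> configs M w" "d \<in> configs M w"
       "fst c \<in> Q_non M" "fst d \<in> Q_non M"
    and "outcome M w (superpose \<alpha> c \<beta> d) a r B"
  shows "outcome M w \<psi> a r (Suc B)"
proof -
  have fin: "finite (states M)" using wf by (simp add: qfa_reset_wf_def)
  have "outcome M w \<psi> (a + (\<Sum>x\<in>{c,d}. (cmod (superpose \<alpha> c \<beta> d x))\<^sup>2 * 0))
     (r + (\<Sum>x\<in>{c,d}. (cmod (superpose \<alpha> c \<beta> d x))\<^sup>2 * 0)) (Suc B)"
    using assms fin
    by (intro outcome_step)
      (auto simp: proj_superpose intro: gains_mono[OF gains_nonhalting[OF wf]],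
       auto simp: superpose_def ket_def)
  then show ?thesis by simp
qed

text \<open>By linearity the branches move independently as long as neither halts; the common
  exponent \<open>t\<close> expresses that they share one clock.\<close>

lemma outcome_moves:
  assumes wf: "qfa_reset_wf M"
    and "(c, c') \<in> moves M w ^^ t" "(d, d') \<in> moves M w ^^ t"
    and "outcome M w (superpose \<alpha> c' \<beta> d') a r B"
  shows "outcome M w (superpose \<alpha> c \<beta> d) a r (t + B)"
  using assms(2,3)
proof (induction t arbitrary: c d)
  case 0
  then show ?case using assms(4) by simp
next
  case (Suc t)
  obtain c1 d1 where c1: "(c, c1) \<in> moves M w" "(c1, c') \<in> moves M w ^^ t"
    and d1: "(d, d1) \<in> moves M w" "(d1, d') \<in> moves M w ^^ t"
    using Suc.prems by (meson relpow_Suc_E2)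
  have fin: "finite (states M)" using wf by (simp add: qfa_reset_wf_def)
  have "evol M w (superpose \<alpha> c \<beta> d) = superpose \<alpha> c1 \<beta> d1"
    using c1(1) d1(1) fin by (auto simp: moves_def evol_superpose) (simp add: superpose_def)
  then show ?case
    using outcome_nonhalting[OF wf _ _ _ _ _ Suc.IH[OF c1(2) d1(2)]] c1(1) d1(1)
    by (auto simp: moves_def)
qed

lemma outcome_moves_ket:
  assumes "qfa_reset_wf M" "(c, c') \<in> moves M w ^^ t" "outcome M w (ket c') a r B"
  shows "outcome M w (ket c) a r (t + B)"
  using outcome_moves[OF assms(1,2,2), of 1 0] assms(3) by (simp add: superpose_single)

text \<open>Only the image of \<psi> has to be a basis vector, so this also covers the interference
  step, where two configurations are carried to a single one. Reset states are included through
  \<open>gains\<close>.\<close>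

lemma outcome_halt:
  assumes wf: "qfa_reset_wf M" and "evol M w \<psi> = ket c" "c \<in> configs M w" "fst c \<notin> Q_non M"
    and "gains M w (fst c) a r B"
  shows "outcome M w \<psi> a r (Suc B)"
proof -
  have fin: "finite (states M)" using wf by (simp add: qfa_reset_wf_def)
  have "proj (Q_non M) (ket c) = (\<lambda>_. 0)"
    using assms(4) by (auto simp: proj_def ket_def fun_eq_iff)
  then have "outcome M w \<psi> (0 + (\<Sum>x\<in>{c}. (cmod (ket c x))\<^sup>2 * a))
      (0 + (\<Sum>x\<in>{c}. (cmod (ket c x))\<^sup>2 * r)) (Suc B)"
    using assms fin
    by (intro outcome_step) (auto simp: ket_def intro: outcome_mono[OF outcome_zero])
  then show ?thesis by (simp add: ket_def)
qed

section \<open>Unitarity of the evolution\<close>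

lemma evol_ket_local:
  assumes fin: "finite (states M)"
    and delta: "\<And>\<sigma> q' d. q' \<in> states M \<Longrightarrow> delta M q \<sigma> q' d = (if d = D q' then V \<sigma> q q' else 0)"
    and D: "\<And>q'. q' \<in> states M \<Longrightarrow> D q' \<in> {-1, 0, 1}"
  shows "evol_ket M w (q, i) (q', i') =
    (if q' \<in> states M \<and> i' = (i + D q') mod int (length (tape w)) then V (tape w ! nat i) q q' else 0)"
proof -
  define A where "A = (if i' = (i + D q') mod int (length (tape w)) then V (tape w ! nat i) q q' else 0)"
  have "(\<Sum>d\<in>{-1, 0, 1}. delta M q (tape w ! nat i) p d * ket (p, (i + d) mod int (length (tape w))) (q', i'))
    = (if p = q' then A else 0)" (is "?S = _") if "p \<in> states M" for p
  proof -
    have "?S = (\<Sum>d\<in>{-1, 0, 1}. if d = D p then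
        V (tape w ! nat i) q p * ket (p, (i + D p) mod int (length (tape w))) (q', i') else 0)"
      by (intro sum.cong refl) (simp add: delta[OF that])
    also have "\<dots> = V (tape w ! nat i) q p * ket (p, (i + D p) mod int (length (tape w))) (q', i')"
      by (subst sum.delta) (use D[OF that] in simp_all)
    also have "\<dots> = (if p = q' then A else 0)"
      by (simp add: ket_def A_def)
    finally show ?thesis .
  qed
  then have "evol_ket M w (q, i) (q', i') = (\<Sum>p\<in>states M. if p = q' then A else 0)"
    unfolding evol_ket_def prod.case by (intro sum.cong refl)
  then show ?thesis using fin by (simp add: A_def)
qed

lemma mod_add_cancel_int:
  fixes i j d N :: int
  assumes "i \<in> {0..<N}" "j \<in> {0..<N}"
  shows "(i + d) mod N = (j + d) mod N \<longleftrightarrow> i = j"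
proof
  assume "(i + d) mod N = (j + d) mod N"
  then have "i mod N = j mod N" by (simp add: mod_eq_dvd_iff)
  then show "i = j" using assms by simp
qed simp

text \<open>The simplification of Kondacs and Watrous: if the head movement is a function of the target
  state, the evolution is unitary as soon as each tape symbol acts unitarily on the states.\<close>

lemma unitary_on_evol_ket:
  fixes M :: "'q qfa_reset"
  assumes fin: "finite (states M)"
    and delta: "\<And>\<sigma> q q' d. q \<in> states M \<Longrightarrow> q' \<in> states M \<Longrightarrow>
      delta M q \<sigma> q' d = (if d = D q' then V \<sigma> q q' else 0)"
    and D: "\<And>q'. q' \<in> states M \<Longrightarrow> D q' \<in> {-1, 0, 1}"
    and V: "\<And>\<sigma>. unitary_on (states M) (V \<sigma>)"
  shows "unitary_on (configs M w) (evol_ket M w)"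
proof -
  define N where "N = int (length (tape w))"
  have N: "N > 0" by (simp add: N_def tape_def)
  define T where "T i = tape w ! nat i" for i
  have ev: "evol_ket M w (q, i) (q', i') = (if i' = (i + D q') mod N then V (T i) q q' else 0)"
    if "q \<in> states M" "q' \<in> states M" for q q' i i'
    unfolding N_def T_def
    by (subst evol_ket_local[where D = D and V = V, OF fin delta[OF that(1)] D]) (use that in auto)
  have V1: "(\<Sum>e\<in>states M. cnj (V \<sigma> c e) * V \<sigma> d e) = (if c = d then 1 else 0)"
    and V2: "(\<Sum>e\<in>states M. V \<sigma> e c * cnj (V \<sigma> e d)) = (if c = d then 1 else 0)"
    if "c \<in> states M" "d \<in> states M" for \<sigma> c d
    using V[of \<sigma>] that by (auto simp: unitary_on_def)
  have S: "configs M w = states M \<times> {0..<N}" by (simp add: configs_def N_def)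
  have 1: "(\<Sum>e\<in>configs M w. cnj (evol_ket M w (q, i) e) * evol_ket M w (p, j) e) =
      (if (q, i) = (p, j) then 1 else 0)"
    if "q \<in> states M" "p \<in> states M" "i \<in> {0..<N}" "j \<in> {0..<N}" for q p i j
  proof -
    \<comment> \<open>Both configurations enter \<open>q'\<close> after the shift
      \<open>D q'\<close>, which is injective modulo \<open>N\<close>; they overlap only for
      \<open>i = j\<close>, and then the same tape symbol acts on both.\<close>
    have row: "(\<Sum>i'\<in>{0..<N}. cnj (evol_ket M w (q, i) (q', i')) * evol_ket M w (p, j) (q', i'))
        = (if i = j then cnj (V (T i) q q') * V (T i) p q' else 0)" if q': "q' \<in> states M" for q'
    proof -
      have row: "(\<Sum>i'\<in>{0..<N}. cnj (evol_ket M w (q, i) (q', i')) * evol_ket M w (p, j) (q', i'))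
        = (\<Sum>i'\<in>{0..<N}. if i' = (i + D q') mod N then
             if i = j then cnj (V (T i) q q') * V (T i) p q' else 0 else 0)"
        using that q' \<open>q \<in> _\<close> \<open>p \<in> _\<close> mod_add_cancel_int[OF \<open>i \<in> _\<close> \<open>j \<in> _\<close>, of "D q'"]
        by (intro sum.cong) (auto simp: ev)
      then show ?thesis using N by simp
    qed
    have "(\<Sum>e\<in>configs M w. cnj (evol_ket M w (q, i) e) * evol_ket M w (p, j) e) =
      (\<Sum>q'\<in>states M. if i = j then cnj (V (T i) q q') * V (T i) p q' else 0)"
      by (simp add: S sum.cartesian_product' row)
    also have "\<dots> = (if (q, i) = (p, j) then 1 else 0)"
      using V1[OF that(1,2)] by (cases "i = j") auto
    finally show ?thesis .
  qed
  have 2: "(\<Sum>e\<in>configs M w. evol_ket M w e (q, i) * cnj (evol_ket M w e (p, j))) =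
      (if (q, i) = (p, j) then 1 else 0)"
    if "q \<in> states M" "p \<in> states M" "i \<in> {0..<N}" "j \<in> {0..<N}" for q p i j
  proof -
    \<comment> \<open>Only from position \<open>i0\<close> can \<open>q\<close> be entered at
      \<open>i\<close>, so everything reduces to the row relation of the single matrix
      \<open>V (T i0)\<close>; for \<open>q = p\<close> the remaining condition says
      \<open>j = i\<close>.\<close>
    define i0 where "i0 = (i - D q) mod N"
    have i0: "i0 \<in> {0..<N}" using N by (simp add: i0_def)
    have "(i0 + D q) mod N = i mod N" by (simp add: i0_def mod_add_left_eq)
    then have i0_D: "(i0 + D q) mod N = i" using \<open>i \<in> _\<close> by simp
    have pre: "i = (i' + D q) mod N \<longleftrightarrow> i' = i0" if "i' \<in> {0..<N}" for i'
      using mod_add_cancel_int[OF that i0, of "D q"] i0_D by (auto simp: eq_commute)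
    have row: "(\<Sum>i'\<in>{0..<N}. evol_ket M w (q', i') (q, i) * cnj (evol_ket M w (q', i') (p, j)))
        = (if j = (i0 + D p) mod N then V (T i0) q' q * cnj (V (T i0) q' p) else 0)"
      if q': "q' \<in> states M" for q'
    proof -
      have row: "(\<Sum>i'\<in>{0..<N}. evol_ket M w (q', i') (q, i) * cnj (evol_ket M w (q', i') (p, j)))
        = (\<Sum>i'\<in>{0..<N}. if i' = i0 then
             if j = (i0 + D p) mod N then V (T i0) q' q * cnj (V (T i0) q' p) else 0 else 0)"
        using q' \<open>q \<in> _\<close> \<open>p \<in> _\<close> by (intro sum.cong) (auto simp: ev pre)
      then show ?thesis using i0 by simp
    qed
    have "(\<Sum>e\<in>configs M w. evol_ket M w e (q, i) * cnj (evol_ket M w e (p, j))) =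
      (\<Sum>q'\<in>states M. if j = (i0 + D p) mod N then V (T i0) q' q * cnj (V (T i0) q' p) else 0)"
      by (simp add: S sum.cartesian_product' row)
    also have "\<dots> = (if j = (i0 + D p) mod N \<and> q = p then 1 else 0)"
      using V2[OF that(1,2)] by (cases "j = (i0 + D p) mod N") auto
    also have "\<dots> = (if (q, i) = (p, j) then 1 else 0)"
      using i0_D by (cases "q = p") auto
    finally show ?thesis .
  qed
  show ?thesis
    unfolding unitary_on_def using 1 2 by (auto simp: S)
qed

section \<open>Building blocks of unitary matrices\<close>

lemma unitary_on_reindex:
  assumes "bij_betw f S S" "unitary_on S U"
  shows "unitary_on S (\<lambda>c. U (f c))"
proof -
  have "(\<Sum>e\<in>S. U (f e) c * cnj (U (f e) d)) = (\<Sum>e\<in>S. U e c * cnj (U e d))" for c d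
    using assms(1) by (rule sum.reindex_bij_betw)
  moreover have "f c \<in> S" if "c \<in> S" for c
    using assms(1) that by (auto simp: bij_betw_def)
  moreover have "f c = f d \<longleftrightarrow> c = d" if "c \<in> S" "d \<in> S" for c d
    using assms(1) that by (auto simp: bij_betw_def inj_on_def)
  ultimately show ?thesis
    using assms(2) by (simp add: unitary_on_def)
qed

text \<open>A direct sum of \<open>k\<close> copies of \<open>U\<close>: in either inner product
  only the indices \<open>m * i + s\<close> of one block contribute, and \<open>block\<close> turns
  the sum into one over \<open>s < m\<close>.\<close>

lemma unitary_on_blocks:
  fixes U :: "nat \<Rightarrow> nat \<Rightarrow> complex"
  assumes U: "unitary_on {..<m} U"
  shows "unitary_on {..<m * k} (\<lambda>c d. if c div m = d div m then U (c mod m) (d mod m) else 0)"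
proof -
  have cm: "c div m < k" "c mod m < m" if "c < m * k" for c
    using that by (auto simp: less_mult_imp_div_less mult.commute) (cases "m = 0"; simp)
  have block: "(\<Sum>e<m * k. if e div m = i then f (e mod m) else 0) = (\<Sum>s<m. f s)"
    if "i < k" for f :: "nat \<Rightarrow> complex" and i
  proof -
    have "m * i + s < m * k" if "s < m" for s
    proof -
      have "m * i + s < m * Suc i" using that by simp
      also have "\<dots> \<le> m * k" using \<open>i < k\<close> by (intro mult_le_mono2) simp
      finally show ?thesis .
    qed
    then have "(\<Sum>s<m. f s) = (\<Sum>e | e < m * k \<and> e div m = i. f (e mod m))"
      by (intro sum.reindex_bij_witness[of _ "\<lambda>e. e mod m" "\<lambda>s. m * i + s"])
        (auto intro: cm(2))
    also have "\<dots> = (\<Sum>e<m * k. if e div m = i then f (e mod m) else 0)"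
      by (rule sum.mono_neutral_cong_left) auto
    finally show ?thesis by simp
  qed
  have eq: "c = d \<longleftrightarrow> c div m = d div m \<and> c mod m = d mod m" for c d :: nat
    by (metis div_mult_mod_eq)
  let ?B = "\<lambda>c d. if c div m = d div m then U (c mod m) (d mod m) else 0"
  have "(\<Sum>e<m*k. cnj (?B c e) * ?B d e) = (if c = d then 1 else 0)" if "c < m*k" "d < m*k" for c d
  proof -
    have "(\<Sum>e<m*k. cnj (?B c e) * ?B d e) = (\<Sum>e<m*k. if e div m = c div m
        then if c div m = d div m then cnj (U (c mod m) (e mod m)) * U (d mod m) (e mod m) else 0 else 0)"
      by (intro sum.cong) auto
    also have "\<dots> = (\<Sum>s<m. if c div m = d div m then cnj (U (c mod m) s) * U (d mod m) s else 0)"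
      by (rule block) (use that cm in auto)
    finally show ?thesis
      using U cm[OF that(1)] cm[OF that(2)]
      by (cases "c div m = d div m") (simp_all add: unitary_on_def eq[of c d])
  qed
  moreover have "(\<Sum>e<m*k. ?B e c * cnj (?B e d)) = (if c = d then 1 else 0)" if "c < m*k" "d < m*k" for c d
  proof -
    have "(\<Sum>e<m*k. ?B e c * cnj (?B e d)) = (\<Sum>e<m*k. if e div m = c div m
        then if c div m = d div m then U (e mod m) (c mod m) * cnj (U (e mod m) (d mod m)) else 0 else 0)"
      by (intro sum.cong) auto
    also have "\<dots> = (\<Sum>s<m. if c div m = d div m then U s (c mod m) * cnj (U s (d mod m)) else 0)"
      by (rule block) (use that cm in auto)
    finally show ?thesis
      using U cm[OF that(1)] cm[OF that(2)]
      by (cases "c div m = d div m") (simp_all add: unitary_on_def eq[of c d])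
  qed
  ultimately show ?thesis by (simp add: unitary_on_def)
qed

definition half_amp :: complex where "half_amp = complex_of_real (1 / sqrt 2)"

lemma half_amp_sq: "half_amp * half_amp = 1 / 2" "cnj half_amp = half_amp" "cmod half_amp ^ 2 = 1 / 2"
  by (simp_all add: half_amp_def power_divide norm_divide flip: of_real_mult)

text \<open>The 2 by 2 Hadamard matrix on the span of \<open>x\<close> and \<open>y\<close>, the
  identity elsewhere; \<open>s\<close> is the source state and \<open>s'\<close> the target.\<close>

definition hadamard :: "nat \<Rightarrow> nat \<Rightarrow> nat \<Rightarrow> nat \<Rightarrow> complex" where
  "hadamard x y s s' =
     (if s = x then half_amp * of_bool (s' = x) + half_amp * of_bool (s' = y)
      else if s = y then half_amp * of_bool (s' = x) - half_amp * of_bool (s' = y)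
      else of_bool (s' = s))"

text \<open>The matrix is self-adjoint, so the two unitarity equations coincide. \<open>row\<close>
  gives the action on an arbitrary vector \<open>f\<close>, which is then taken to be another
  column.\<close>

lemma unitary_on_hadamard:
  assumes "finite S" "x \<in> S" "y \<in> S" "x \<noteq> y"
  shows "unitary_on S (hadamard x y)"
proof -
  have sym: "hadamard x y c e = cnj (hadamard x y e c)" for c e
    using assms(4) by (auto simp: hadamard_def half_amp_sq)
  have row: "(\<Sum>e\<in>S. cnj (hadamard x y c e) * f e) =
    (if c = x then half_amp * f x + half_amp * f y
     else if c = y then half_amp * f x - half_amp * f y else f c)" if "c \<in> S" for c f
  proof -
    have d: "(\<Sum>e\<in>S. of_bool (e = z) * f e) = f z" if "z \<in> S" for z
    proof -
      have "(\<Sum>e\<in>S. of_bool (e = z) * f e) = (\<Sum>e\<in>S. if e = z then f e else 0)"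
        by (intro sum.cong) auto
      then show ?thesis using assms that by simp
    qed
    have "cnj (of_bool b) = of_bool b" for b by simp
    then show ?thesis
      using assms that
      by (simp add: hadamard_def half_amp_sq algebra_simps sum.distrib sum_subtractf d
          flip: sum_distrib_left)
  qed
  have 1: "(\<Sum>e\<in>S. cnj (hadamard x y c e) * hadamard x y d e) = (if c = d then 1 else 0)"
    if "c \<in> S" "d \<in> S" for c d
    unfolding row[OF that(1)] using assms(4) by (auto simp: hadamard_def half_amp_sq)
  moreover have "(\<Sum>e\<in>S. hadamard x y e c * cnj (hadamard x y e d)) = (if c = d then 1 else 0)"
    if "c \<in> S" "d \<in> S" for c d
  proof -
    have "(\<Sum>e\<in>S. hadamard x y e c * cnj (hadamard x y e d)) =
        (\<Sum>e\<in>S. cnj (hadamard x y c e) * hadamard x y d e)"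
      by (intro sum.cong refl arg_cong2[where f = "(*)"]) (metis sym complex_cnj_cnj)+
    then show ?thesis using 1[OF that] by simp
  qed
  ultimately show ?thesis by (simp add: unitary_on_def)
qed

lemma unitary_on_of_bool:
  assumes "finite S"
  shows "unitary_on S (\<lambda>c d. of_bool (d = c))"
proof -
  have "(\<Sum>e\<in>S. cnj (of_bool (e = c)) * of_bool (e = d)) = (if c = d then 1 else 0)"
    "(\<Sum>e\<in>S. of_bool (c = e) * cnj (of_bool (d = e))) = (if c = d then 1 else 0)"
    if "c \<in> S" for c d
  proof -
    have "(\<Sum>e\<in>S. cnj (of_bool (e = c)) * of_bool (e = d)) = (\<Sum>e\<in>S. if e = c then of_bool (c = d) else 0)"
      "(\<Sum>e\<in>S. of_bool (c = e) * cnj (of_bool (d = e))) = (\<Sum>e\<in>S. if e = c then of_bool (c = d) else 0)"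
      by (intro sum.cong; auto)+
    then show "(\<Sum>e\<in>S. cnj (of_bool (e = c)) * of_bool (e = d)) = (if c = d then 1 else 0)"
      "(\<Sum>e\<in>S. of_bool (c = e) * cnj (of_bool (d = e))) = (if c = d then 1 else 0)"
      using assms that by (simp_all only: sum.delta) auto
  qed
  then show ?thesis unfolding unitary_on_def by blast
qed

section \<open>The machine\<close>

text \<open>The number $13 i + s$ stands for state \<open>s\<close> of copy \<open>i\<close>. On the first $b$ the scan steps back to
  the preceding symbol in state \<open>turn\<close> and returns in state \<open>scan_b\<close>: going directly from \<open>scan_a\<close> to
  \<open>scan_b\<close> would not be injective, since \<open>scan_b\<close> also stays \<open>scan_b\<close> on $b$. For the same reason
  the two states reaching the right end-marker have separate targets \<open>ok_a\<close> and \<open>ok_ab\<close>.\<close>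

abbreviation (input) scan_a :: nat where "scan_a \<equiv> 0"
abbreviation (input) turn :: nat where "turn \<equiv> 1"
abbreviation (input) scan_b :: nat where "scan_b \<equiv> 2"
abbreviation (input) bad :: nat where "bad \<equiv> 3"
abbreviation (input) ok_a :: nat where "ok_a \<equiv> 4"
abbreviation (input) ok_ab :: nat where "ok_ab \<equiv> 5"
abbreviation (input) fork :: nat where "fork \<equiv> 6"
abbreviation (input) slow_b :: nat where "slow_b \<equiv> 7"
abbreviation (input) pause_b :: nat where "pause_b \<equiv> 8"
abbreviation (input) slow_a :: nat where "slow_a \<equiv> 9"
abbreviation (input) pause_a :: nat where "pause_a \<equiv> 10"
abbreviation (input) same :: nat where "same \<equiv> 11"
abbreviation (input) differ :: nat where "differ \<equiv> 12"

text \<open>The argument is the state being entered: entering a pausing state keeps the head on its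
  letter, and the move happens on the return to the slow state.\<close>

definition head_move :: "nat \<Rightarrow> int" where
  "head_move s =
     (if s = scan_a \<or> s = scan_b \<or> s = slow_b \<or> s = slow_a then 1 else if s = turn then -1 else 0)"

text \<open>Transitions that no computation uses, such as leaving \<open>bad\<close>, only complete the partial
  injections to permutations.\<close>

definition perm :: "tape_symbol \<Rightarrow> nat \<Rightarrow> nat" where
  "perm \<sigma> = (case \<sigma> of
      Letter La \<Rightarrow> transpose slow_a pause_a \<circ> transpose turn bad \<circ> transpose turn scan_b
    | Letter Lb \<Rightarrow> transpose scan_a turn \<circ> transpose slow_b pause_b
    | LeftEnd \<Rightarrow> transpose turn scan_b \<circ> transpose fork slow_a \<circ> transpose fork slow_b
    | RightEnd \<Rightarrow> transpose scan_a ok_a \<circ> transpose scan_b ok_ab \<circ>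
        transpose slow_b same \<circ> transpose slow_a differ)"

text \<open>On the end-markers a Hadamard follows the permutation. At the left it splits
  \<open>slow_b\<close>, the image of \<open>fork\<close>; at the right it mixes \<open>same\<close>
  and \<open>differ\<close>, the images of \<open>slow_b\<close> and \<open>slow_a\<close>, so that
  equal amplitudes arriving together leave \<open>differ\<close> empty.\<close>

definition amp :: "tape_symbol \<Rightarrow> nat \<Rightarrow> nat \<Rightarrow> complex" where
  "amp \<sigma> s = (case \<sigma> of
      LeftEnd \<Rightarrow> hadamard slow_b slow_a (perm \<sigma> s)
    | RightEnd \<Rightarrow> hadamard same differ (perm \<sigma> s)
    | Letter _ \<Rightarrow> (\<lambda>s'. of_bool (s' = perm \<sigma> s)))"

lemma bij_perm: "bij_betw (perm \<sigma>) {..<13} {..<13}"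
proof -
  have "perm \<sigma> permutes {..<13}"
    unfolding perm_def
    by (auto split: tape_symbol.split letter.split intro!: permutes_compose permutes_swap_id)
  then show ?thesis by (rule permutes_imp_bij)
qed

lemma unitary_on_amp: "unitary_on {..<13} (amp \<sigma>)"
proof -
  define U where "U = (case \<sigma> of
      LeftEnd \<Rightarrow> hadamard slow_b slow_a
    | RightEnd \<Rightarrow> hadamard same differ
    | Letter _ \<Rightarrow> (\<lambda>s s'. of_bool (s' = s)))"
  have "unitary_on {..<13} U"
    unfolding U_def
    by (cases \<sigma>) (auto intro!: unitary_on_hadamard unitary_on_of_bool)
  then have "unitary_on {..<13} (\<lambda>s. U (perm \<sigma> s))"
    by (rule unitary_on_reindex[OF bij_perm])
  moreover have "(\<lambda>s. U (perm \<sigma> s)) = amp \<sigma>"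
    by (auto simp: U_def amp_def split: tape_symbol.split)
  ultimately show ?thesis by simp
qed

section \<open>The chain of copies and its well-formedness\<close>

text \<open>\<open>delta\<close> never leaves a copy; only resets connect copies. In the last copy
  the reset target of \<open>same\<close> would be \<open>13 * k\<close>, which is not a state, so
  this \<open>same\<close> belongs to no reset set with a nonhalting index and is purely
  accepting.\<close>

definition eq_machine :: "nat \<Rightarrow> nat qfa_reset" where
  "eq_machine k =
    \<lparr>Q_non = {q. q < 13 * k \<and> q mod 13 \<in> {scan_a, turn, scan_b, fork, slow_b, pause_b, slow_a, pause_a}},
     Q_acc = {q. q < 13 * k \<and> q mod 13 = same \<and> Suc (q div 13) = k},
     Q_rej = {q. q < 13 * k \<and> q mod 13 \<in> {bad, differ}},
     Q_reset = (\<lambda>p. {q. q < 13 * k \<and>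
       (q mod 13 \<in> {ok_a, ok_ab} \<and> p = 13 * (q div 13) + fork \<or>
        q mod 13 = same \<and> p = 13 * Suc (q div 13) + scan_a)}),
     init = scan_a,
     delta = (\<lambda>q \<sigma> q' d. if d = head_move (q' mod 13)
       then if q div 13 = q' div 13 then amp \<sigma> (q mod 13) (q' mod 13) else 0 else 0)\<rparr>"

lemma block_less: "i < k \<Longrightarrow> s < m \<Longrightarrow> m * i + s < m * (k::nat)"
  using mult_le_mono2[of "Suc i" k m] by simp

lemma less_13_cases:
  assumes "s < 13"
  shows "s \<in> {scan_a, turn, scan_b, fork, slow_b, pause_b, slow_a, pause_a} \<or> s \<in> {bad, differ} \<or>
    s \<in> {ok_a, ok_ab} \<or> s = same"
proof -
  have "s \<in> {..<13}" using assms by simp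
  also have "{..<13} = {12, 11, 10, 9, 8, 7, 6, 5, 4, 3, 2, 1, 0::nat}"
    by (simp add: lessThan_nat_numeral lessThan_Suc)
  finally show ?thesis by blast
qed

text \<open>A reset state counts only if its target is nonhalting. For \<open>ok_a\<close> and
  \<open>ok_ab\<close> the target is the \<open>fork\<close> of the same copy; for
  \<open>same\<close> it exists only if there is a next copy, hence the split into the last two
  cases.\<close>

lemma states_eq_machine: "states (eq_machine k) = {..<13 * k}"
proof
  show "states (eq_machine k) \<subseteq> {..<13 * k}"
    unfolding states_def eq_machine_def by auto
  show "{..<13 * k} \<subseteq> states (eq_machine k)"
  proof
    fix q assume "q \<in> {..<13 * k}"
    then have q: "q < 13 * k" "q div 13 < k" by auto
    have Q: "Q_non (eq_machine k) \<subseteq> states (eq_machine k)" "Q_acc (eq_machine k) \<subseteq> states (eq_machine k)"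
      "Q_rej (eq_machine k) \<subseteq> states (eq_machine k)"
      "\<And>p. p \<in> Q_non (eq_machine k) \<Longrightarrow> Q_reset (eq_machine k) p \<subseteq> states (eq_machine k)"
      by (auto simp: states_def)
    have fork: "13 * (q div 13) + fork \<in> Q_non (eq_machine k)"
      using block_less[OF q(2), of fork 13] by (simp add: eq_machine_def)
    consider "q mod 13 \<in> {scan_a, turn, scan_b, fork, slow_b, pause_b, slow_a, pause_a}"
      | "q mod 13 \<in> {bad, differ}" | "q mod 13 \<in> {ok_a, ok_ab}"
      | "q mod 13 = same" "Suc (q div 13) = k" | "q mod 13 = same" "Suc (q div 13) < k"
      using less_13_cases[of "q mod 13"] q(2) by fastforce
    then show "q \<in> states (eq_machine k)"
    proof cases
      case 1
      then have "q \<in> Q_non (eq_machine k)" using q(1) by (simp add: eq_machine_def)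
      then show ?thesis using Q(1) by blast
    next
      case 2
      then have "q \<in> Q_rej (eq_machine k)" using q(1) by (simp add: eq_machine_def)
      then show ?thesis using Q(3) by blast
    next
      case 3
      then have "q \<in> Q_reset (eq_machine k) (13 * (q div 13) + fork)"
        using q(1) by (simp add: eq_machine_def)
      then show ?thesis using Q(4)[OF fork] by blast
    next
      case 4
      then have "q \<in> Q_acc (eq_machine k)" using q(1) by (simp add: eq_machine_def)
      then show ?thesis using Q(2) by blast
    next
      case 5
      then have "13 * Suc (q div 13) + scan_a \<in> Q_non (eq_machine k)"
        using block_less[OF 5(2), of scan_a 13] by (simp add: eq_machine_def)
      moreover have "q \<in> Q_reset (eq_machine k) (13 * Suc (q div 13) + scan_a)"
        using 5 q(1) by (simp add: eq_machine_def)
      ultimately show ?thesis using Q(4) by blast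
    qed
  qed
qed

lemma delta_eq_machine:
  "delta (eq_machine k) q \<sigma> q' d = (if d = head_move (q' mod 13)
     then if q div 13 = q' div 13 then amp \<sigma> (q mod 13) (q' mod 13) else 0 else 0)"
  by (simp add: eq_machine_def)

lemma qfa_reset_wf_eq_machine:
  assumes "k > 0"
  shows "qfa_reset_wf (eq_machine k)"
proof -
  let ?V = "\<lambda>\<sigma> q q'. if q div 13 = q' div 13 then amp \<sigma> (q mod 13) (q' mod 13) else 0"
  have "unitary_on (configs (eq_machine k) w) (evol_ket (eq_machine k) w)" for w
  proof (rule unitary_on_evol_ket[where V = ?V and D = "\<lambda>q. head_move (q mod 13)"])
    show "unitary_on (states (eq_machine k)) (?V \<sigma>)" for \<sigma>
      unfolding states_eq_machine by (intro unitary_on_blocks unitary_on_amp)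
  qed (simp_all add: states_eq_machine delta_eq_machine head_move_def)
  moreover have "disjoint_family_on (Q_reset (eq_machine k)) (Q_non (eq_machine k))"
  proof -
    define f :: "nat \<Rightarrow> nat" where
      "f q = (if q mod 13 = same then 13 * Suc (q div 13) else 13 * (q div 13) + fork)" for q
    have "p = f q" if "q \<in> Q_reset (eq_machine k) p" for p q
      using that by (auto simp: eq_machine_def f_def)
    then show ?thesis unfolding disjoint_family_on_def by blast
  qed
  moreover have "disjnt (Q_non (eq_machine k)) (Q_acc (eq_machine k))"
    "disjnt (Q_non (eq_machine k)) (Q_rej (eq_machine k))"
    "disjnt (Q_acc (eq_machine k)) (Q_rej (eq_machine k))"
    by (auto simp: disjnt_iff eq_machine_def)
  moreover have "disjnt (Q_non (eq_machine k) \<union> Q_acc (eq_machine k) \<union> Q_rej (eq_machine k))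
      (\<Union>p\<in>Q_non (eq_machine k). Q_reset (eq_machine k) p)"
  proof -
    \<comment> \<open>A nonhalting \<open>p\<close> lies below \<open>13 * k\<close>; this gives
      \<open>Suc (q div 13) < k\<close>, which separates the resetting \<open>same\<close> from the
      accepting one.\<close>
    have "q mod 13 \<in> {ok_a, ok_ab} \<or> q mod 13 = same \<and> Suc (q div 13) < k"
      if "q \<in> Q_reset (eq_machine k) p" "p \<in> Q_non (eq_machine k)" for p q
      using that by (auto simp: eq_machine_def)
    moreover have "\<not> (q mod 13 \<in> {ok_a, ok_ab} \<or> q mod 13 = same \<and> Suc (q div 13) < k)"
      if "q \<in> Q_non (eq_machine k) \<union> Q_acc (eq_machine k) \<union> Q_rej (eq_machine k)" for q
      using that by (auto simp: eq_machine_def)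
    ultimately show ?thesis
      unfolding disjnt_iff by blast
  qed
  moreover have "init (eq_machine k) \<in> Q_non (eq_machine k)"
    using assms by (simp add: eq_machine_def)
  ultimately show ?thesis
    unfolding qfa_reset_wf_def by (simp add: states_eq_machine)
qed

lemma evol_ket_eq_machine:
  assumes "i < k" "s < 13" "x < 13" "y < 13"
    and amp: "\<And>u. amp (tape w ! nat p) s u = \<alpha> * of_bool (u = x) + \<beta> * of_bool (u = y)"
  shows "evol_ket (eq_machine k) w (13 * i + s, p) = superpose
    \<alpha> (13 * i + x, (p + head_move x) mod int (length (tape w)))
    \<beta> (13 * i + y, (p + head_move y) mod int (length (tape w)))"
proof
  fix c :: "nat config"
  obtain q' p' where c: "c = (q', p')" by force
  let ?V = "\<lambda>\<sigma> q q'. if q div 13 = q' div 13 then amp \<sigma> (q mod 13) (q' mod 13) else 0"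
  have "evol_ket (eq_machine k) w (13 * i + s, p) (q', p') =
    (if q' \<in> states (eq_machine k) \<and> p' = (p + head_move (q' mod 13)) mod int (length (tape w))
     then ?V (tape w ! nat p) (13 * i + s) q' else 0)"
    by (rule evol_ket_local) (simp_all add: states_eq_machine delta_eq_machine head_move_def)
  also have "\<dots> = \<alpha> * of_bool (q' = 13 * i + x \<and> p' = (p + head_move x) mod int (length (tape w)))
     + \<beta> * of_bool (q' = 13 * i + y \<and> p' = (p + head_move y) mod int (length (tape w)))"
  proof (cases "q' div 13 = i")
    case True
    define z where "z = q' mod 13"
    have q': "q' = 13 * i + z" "z < 13" using True by (auto simp: z_def)
    have "q' < 13 * k" unfolding q'(1) using \<open>i < k\<close> q'(2) by (rule block_less)
    moreover have "(13 * i + s) div 13 = i" "(13 * i + s) mod 13 = s" using assms(2) by auto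
    moreover have "q' = 13 * i + u \<longleftrightarrow> z = u" for u using q'(1) by auto
    ultimately show ?thesis
      using True by (simp only: states_eq_machine amp z_def[symmetric]) auto
  next
    case False
    then have "q' \<noteq> 13 * i + x" "q' \<noteq> 13 * i + y"
      using assms(3,4) by auto
    then show ?thesis using False assms(2) by simp
  qed
  finally show "evol_ket (eq_machine k) w (13 * i + s, p) c = superpose
    \<alpha> (13 * i + x, (p + head_move x) mod int (length (tape w)))
    \<beta> (13 * i + y, (p + head_move y) mod int (length (tape w))) c"
    by (simp add: c superpose_def ket_def)
qed

section \<open>One round\<close>

lemma relpow_run:
  assumes "\<And>j. j < t \<Longrightarrow> (f j, f (Suc j)) \<in> R ^^ s"
  shows "(f 0, f t) \<in> R ^^ (s * t)"
  using assms
proof (induction t)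
  case (Suc t)
  then have "(f 0, f (Suc t)) \<in> R ^^ (s * t + s)"
    by (intro relpow_trans[of _ "f t"]) auto
  then show ?case by (simp add: add.commute)
qed simp

text \<open>The transition table on the pairs of symbol and state that computations meet. All later
  reasoning about runs rests on it rather than on \<open>perm\<close>.\<close>

lemma amp_eq:
  "amp (Letter La) scan_a u = of_bool (u = scan_a)"
  "amp (Letter La) turn u = of_bool (u = scan_b)"
  "amp (Letter La) scan_b u = of_bool (u = bad)"
  "amp (Letter La) slow_b u = of_bool (u = slow_b)"
  "amp (Letter La) slow_a u = of_bool (u = pause_a)"
  "amp (Letter La) pause_a u = of_bool (u = slow_a)"
  "amp (Letter Lb) scan_a u = of_bool (u = turn)"
  "amp (Letter Lb) scan_b u = of_bool (u = scan_b)"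
  "amp (Letter Lb) slow_b u = of_bool (u = pause_b)"
  "amp (Letter Lb) pause_b u = of_bool (u = slow_b)"
  "amp (Letter Lb) slow_a u = of_bool (u = slow_a)"
  "amp LeftEnd scan_a u = of_bool (u = scan_a)"
  "amp LeftEnd turn u = of_bool (u = scan_b)"
  "amp LeftEnd fork u = half_amp * of_bool (u = slow_b) + half_amp * of_bool (u = slow_a)"
  "amp RightEnd scan_a u = of_bool (u = ok_a)"
  "amp RightEnd scan_b u = of_bool (u = ok_ab)"
  "amp RightEnd slow_b u = half_amp * of_bool (u = same) + half_amp * of_bool (u = differ)"
  "amp RightEnd slow_a u = half_amp * of_bool (u = same) - half_amp * of_bool (u = differ)"
  by (simp_all add: amp_def perm_def hadamard_def transpose_def)

lemma length_tape: "length (tape w) = length w + 2"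
  by (simp add: tape_def)

lemma tape_LeftEnd: "tape w ! 0 = LeftEnd"
  by (simp add: tape_def)

lemma tape_RightEnd: "tape w ! Suc (length w) = RightEnd"
  by (simp add: tape_def nth_append)

lemma tape_letter: "j < length w \<Longrightarrow> tape w ! Suc j = Letter (w ! j)"
  by (simp add: tape_def nth_append)

lemma config_eq_machine:
  "i < k \<Longrightarrow> s < 13 \<Longrightarrow> p < length w + 2 \<Longrightarrow> (13 * i + s, int p) \<in> configs (eq_machine k) w"
  by (simp add: configs_def states_eq_machine block_less length_tape)

lemma Q_eq_machine:
  assumes "i < k" "s < 13"
  shows "13 * i + s \<in> Q_non (eq_machine k) \<longleftrightarrow>
      s \<in> {scan_a, turn, scan_b, fork, slow_b, pause_b, slow_a, pause_a}"
    and "13 * i + s \<in> Q_rej (eq_machine k) \<longleftrightarrow> s \<in> {bad, differ}"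
    and "13 * i + s \<in> Q_acc (eq_machine k) \<longleftrightarrow> s = same \<and> Suc i = k"
    and "13 * i + s \<in> Q_reset (eq_machine k) p \<longleftrightarrow>
      s \<in> {ok_a, ok_ab} \<and> p = 13 * i + fork \<or> s = same \<and> p = 13 * Suc i + scan_a"
proof -
  have "13 * i + s < 13 * k" "(13 * i + s) mod 13 = s" "(13 * i + s) div 13 = i"
    using block_less[OF assms] assms(2) by auto
  then show "13 * i + s \<in> Q_non (eq_machine k) \<longleftrightarrow>
      s \<in> {scan_a, turn, scan_b, fork, slow_b, pause_b, slow_a, pause_a}"
    and "13 * i + s \<in> Q_rej (eq_machine k) \<longleftrightarrow> s \<in> {bad, differ}"
    and "13 * i + s \<in> Q_acc (eq_machine k) \<longleftrightarrow> s = same \<and> Suc i = k"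
    and "13 * i + s \<in> Q_reset (eq_machine k) p \<longleftrightarrow>
      s \<in> {ok_a, ok_ab} \<and> p = 13 * i + fork \<or> s = same \<and> p = 13 * Suc i + scan_a"
    unfolding eq_machine_def by simp_all
qed

lemma evol_ket_det:
  assumes "i < k" "s < 13" "t < 13" "p' < length w + 2" "int p' = int p + head_move t"
    and "\<And>u. amp (tape w ! p) s u = of_bool (u = t)"
  shows "evol_ket (eq_machine k) w (13 * i + s, int p) = ket (13 * i + t, int p')"
proof -
  have "(int p + head_move t) mod int (length (tape w)) = int p'"
    unfolding assms(5)[symmetric] using assms(4) by (simp add: length_tape)
  moreover have "amp (tape w ! nat (int p)) s u = 1 * of_bool (u = t) + 0 * of_bool (u = t)" for u
    using assms(6) by simp
  ultimately show ?thesis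
    using evol_ket_eq_machine[OF assms(1-3,3), of w "int p" 1 0] by (simp only: superpose_single)
qed

lemma moves_eq_machine:
  assumes "i < k" "s < 13" "t \<in> {scan_a, turn, scan_b, fork, slow_b, pause_b, slow_a, pause_a}"
    and "p < length w + 2" "p' < length w + 2" "int p' = int p + head_move t"
    and "\<And>u. amp (tape w ! p) s u = of_bool (u = t)"
  shows "((13 * i + s, int p), (13 * i + t, int p')) \<in> moves (eq_machine k) w"
proof -
  have t: "t < 13" using assms(3) by auto
  show ?thesis
    unfolding moves_def
    using evol_ket_det[OF assms(1,2) t assms(5-7)] Q_eq_machine(1)[OF assms(1) t] assms(3)
      config_eq_machine[OF assms(1,2,4)] config_eq_machine[OF assms(1) t assms(5)]
    by (simp only: mem_Collect_eq prod.case fst_conv)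
qed

lemma moves_run:
  assumes "i < k" "s \<in> {scan_a, scan_b, slow_b, slow_a}" "p + t < length w + 2"
    and "\<And>j u. j < t \<Longrightarrow> amp (tape w ! (p + j)) s u = of_bool (u = s)"
  shows "((13 * i + s, int p), (13 * i + s, int (p + t))) \<in> moves (eq_machine k) w ^^ t"
proof -
  have "((13 * i + s, int (p + j)), (13 * i + s, int (p + Suc j))) \<in> moves (eq_machine k) w ^^ 1"
    if "j < t" for j
    unfolding relpow_1
    by (rule moves_eq_machine) (use assms that in \<open>auto simp: head_move_def\<close>)
  from relpow_run[of t "\<lambda>j. (13 * i + s, int (p + j))", OF this] show ?thesis by simp
qed

text \<open>Two steps per cell: the first enters \<open>s'\<close> without moving, the second
  re-enters \<open>s\<close> and advances.\<close>

lemma moves_run_pausing: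
  assumes "i < k" "s = slow_b \<and> s' = pause_b \<or> s = slow_a \<and> s' = pause_a" "p + t < length w + 2"
    and "\<And>j u. j < t \<Longrightarrow> amp (tape w ! (p + j)) s u = of_bool (u = s')"
    and "\<And>j u. j < t \<Longrightarrow> amp (tape w ! (p + j)) s' u = of_bool (u = s)"
  shows "((13 * i + s, int p), (13 * i + s, int (p + t))) \<in> moves (eq_machine k) w ^^ (2 * t)"
proof -
  have "((13 * i + s, int (p + j)), (13 * i + s, int (p + Suc j))) \<in> moves (eq_machine k) w ^^ 2"
    if "j < t" for j
  proof -
    have "((13 * i + s, int (p + j)), (13 * i + s', int (p + j))) \<in> moves (eq_machine k) w"
      by (rule moves_eq_machine) (use assms that in \<open>auto simp: head_move_def\<close>)
    moreover have "((13 * i + s', int (p + j)), (13 * i + s, int (p + Suc j))) \<in> moves (eq_machine k) w"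
      by (rule moves_eq_machine) (use assms that in \<open>auto simp: head_move_def\<close>)
    ultimately show ?thesis by (auto simp: numeral_2_eq_2)
  qed
  from relpow_run[of t "\<lambda>j. (13 * i + s, int (p + j))", OF this] show ?thesis by simp
qed

lemma superpose_commute: "superpose \<alpha> c \<beta> d = superpose \<beta> d \<alpha> c"
  by (auto simp: superpose_def)

lemma outcome_scale:
  assumes "outcome M w \<psi> a r B"
  shows "outcome M w (\<lambda>c. half_amp * \<psi> c) (a / 2) (r / 2) B"
  using assms halt_prob_scale[of "1 / sqrt 2" M w _ _ \<psi>]
  by (simp add: outcome_def half_amp_def power_divide)

lemma outcome_scan_halt:
  assumes "i < k" "s < 13" "t \<in> {bad, ok_a, ok_ab}" "p < length w + 2"
    and "\<And>u. amp (tape w ! p) s u = of_bool (u = t)"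
    and "gains (eq_machine k) w (13 * i + t) a r B"
  shows "outcome (eq_machine k) w (ket (13 * i + s, int p)) a r (Suc B)"
proof (rule outcome_halt)
  have t: "t < 13" "head_move t = 0" using assms(3) by (auto simp: head_move_def)
  show "qfa_reset_wf (eq_machine k)" using assms(1) by (intro qfa_reset_wf_eq_machine) simp
  have "evol_ket (eq_machine k) w (13 * i + s, int p) = ket (13 * i + t, int p)"
    by (rule evol_ket_det) (use assms t in auto)
  then show "evol (eq_machine k) w (ket (13 * i + s, int p)) = ket (13 * i + t, int p)"
    by (subst evol_ket_configs) (use assms in \<open>auto simp: states_eq_machine intro: config_eq_machine\<close>)
  show "(13 * i + t, int p) \<in> configs (eq_machine k) w"
    using assms t by (intro config_eq_machine) auto
  show "fst (13 * i + t, int p) \<notin> Q_non (eq_machine k)"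
    unfolding fst_conv Q_eq_machine(1)[OF assms(1) t(1)] using assms(3) by auto
  show "gains (eq_machine k) w (fst (13 * i + t, int p)) a r B"
    using assms(6) by simp
qed

text \<open>Copies differ only by the offset \<open>13 * i\<close>, so a round is analysed once, for
  arbitrary \<open>i\<close>. In the applications \<open>rest\<close> is empty or begins with an a
  that follows a b.\<close>

locale ab_word =
  fixes k i n m :: nat and w rest :: "letter list"
  assumes i: "i < k" and w: "w = replicate n La @ replicate m Lb @ rest"
begin

abbreviation "M \<equiv> eq_machine k"
abbreviation "config s p \<equiv> (13 * i + s, int p)"

lemma wf: "qfa_reset_wf M"
  using i by (intro qfa_reset_wf_eq_machine) simp

lemma length_w: "length w = n + m + length rest"
  by (simp add: w)

lemma tape_a: "j < n \<Longrightarrow> tape w ! Suc j = Letter La"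
  by (subst tape_letter) (simp_all add: w nth_append)

lemma tape_b: "j < m \<Longrightarrow> tape w ! Suc (n + j) = Letter Lb"
  by (subst tape_letter) (simp_all add: w nth_append)

lemma scan_a_run: "(config scan_a 0, config scan_a (n + 1)) \<in> moves M w ^^ (n + 1)"
proof -
  have "(config scan_a 0, config scan_a (0 + (n + 1))) \<in> moves M w ^^ (n + 1)"
  proof (rule moves_run)
    fix j u assume "j < n + 1"
    then show "amp (tape w ! (0 + j)) scan_a u = of_bool (u = scan_a)"
      using tape_a[of "j - 1"] by (cases j) (simp_all add: tape_LeftEnd amp_eq)
  qed (use i length_w in auto)
  then show ?thesis by simp
qed

text \<open>The first b costs two extra steps, one back into \<open>turn\<close> and one forward
  into \<open>scan_b\<close>: the count is \<open>n + 1\<close>, then 2, then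
  \<open>m\<close>.\<close>

lemma scan_b_run:
  assumes "m > 0"
  shows "(config scan_a 0, config scan_b (n + m + 1)) \<in> moves M w ^^ (n + m + 3)"
proof -
  note scan_a_run
  moreover have "(config scan_a (n + 1), config turn n) \<in> moves M w"
    by (rule moves_eq_machine)
      (use i length_w tape_b[of 0] assms in \<open>auto simp: amp_eq head_move_def\<close>)
  moreover have "(config turn n, config scan_b (n + 1)) \<in> moves M w"
  proof (rule moves_eq_machine)
    \<comment> \<open>For \<open>n = 0\<close> the head has stepped back onto the left end-marker,
      which acts on \<open>turn\<close> as the letter a does.\<close>
    show "amp (tape w ! n) turn u = of_bool (u = scan_b)" for u
      using tape_a[of "n - 1"]
      by (cases n) (simp_all only: tape_LeftEnd amp_eq diff_Suc_1 lessI)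
  qed (use i length_w in \<open>auto simp: head_move_def\<close>)
  ultimately have "(config scan_a 0, config scan_b (n + 1)) \<in> moves M w ^^ Suc (Suc (n + 1))"
    by (blast intro: relpow_Suc_I)
  moreover have "(config scan_b (n + 1), config scan_b (n + 1 + m)) \<in> moves M w ^^ m"
    by (rule moves_run) (use i length_w tape_b in \<open>auto simp: amp_eq\<close>)
  ultimately have "(config scan_a 0, config scan_b (n + 1 + m)) \<in> moves M w ^^ (Suc (Suc (n + 1)) + m)"
    by (rule relpow_trans)
  moreover have "Suc (Suc (n + 1)) + m = n + m + 3" "n + 1 + m = n + m + 1" by simp_all
  ultimately show ?thesis by (simp only:)
qed

lemma outcome_scan_bad:
  assumes "rest = La # rest'" "m > 0"
  shows "outcome M w (ket (config scan_a 0)) 0 1 (length w + 4)"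
proof -
  have "tape w ! (n + m + 1) = Letter La"
    using assms by (simp add: tape_letter w nth_append)
  then have "outcome M w (ket (config scan_b (n + m + 1))) 0 1 (Suc 0)"
    using i by (intro outcome_scan_halt[where t = bad] gains_reject[OF wf])
      (auto simp: amp_eq length_w Q_eq_machine)
  from outcome_moves_ket[OF wf scan_b_run[OF assms(2)] this] show ?thesis
    by (rule outcome_mono) (simp add: length_w)
qed

lemma outcome_scan_ok:
  assumes "rest = []" "outcome M w (ket (config fork 0)) a r B"
  shows "outcome M w (ket (config scan_a 0)) a r (B + length w + 4)"
proof -
  have end_symbol: "tape w ! (n + m + 1) = RightEnd"
    using tape_RightEnd[of w] assms(1) by (simp add: length_w)
  have gains: "gains M w (13 * i + t) a r B" if "t \<in> {ok_a, ok_ab}" for t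
    using assms(2) that i
    by (intro gains_reset[OF wf, of "13 * i + fork"]) (auto simp: Q_eq_machine)
  show ?thesis
  proof (cases "m = 0")
    case True
    have "outcome M w (ket (config scan_a (n + 1))) a r (Suc B)"
    proof (rule outcome_scan_halt[where t = ok_a])
      show "amp (tape w ! (n + 1)) scan_a u = of_bool (u = ok_a)" for u
        using end_symbol True by (simp add: amp_eq)
    qed (use i gains length_w in auto)
    from outcome_moves_ket[OF wf scan_a_run this] show ?thesis
      by (rule outcome_mono) (simp add: length_w True)
  next
    case False
    then have m: "m > 0" by simp
    have "outcome M w (ket (config scan_b (n + m + 1))) a r (Suc B)"
    proof (rule outcome_scan_halt[where t = ok_ab])
      show "amp (tape w ! (n + m + 1)) scan_b u = of_bool (u = ok_ab)" for u
        using end_symbol by (simp add: amp_eq)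
    qed (use i gains length_w in auto)
    from outcome_moves_ket[OF wf scan_b_run[OF m] this] show ?thesis
      by (rule outcome_mono) (simp add: length_w)
  qed
qed

lemma slow_b_run:
  assumes "rest = []"
  shows "(config slow_b 1, config slow_b (n + m + 1)) \<in> moves M w ^^ (n + 2 * m)"
proof -
  have "(config slow_b 1, config slow_b (1 + n)) \<in> moves M w ^^ n"
    by (rule moves_run) (use i length_w tape_a in \<open>auto simp: amp_eq\<close>)
  moreover have "(config slow_b (1 + n), config slow_b (1 + n + m)) \<in> moves M w ^^ (2 * m)"
    by (rule moves_run_pausing[where s' = pause_b])
      (use i length_w tape_b in \<open>auto simp: amp_eq\<close>)
  ultimately have "(config slow_b 1, config slow_b (1 + n + m)) \<in> moves M w ^^ (n + 2 * m)"
    by (rule relpow_trans)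
  then show ?thesis by (simp add: algebra_simps)
qed

lemma slow_a_run:
  assumes "rest = []"
  shows "(config slow_a 1, config slow_a (n + m + 1)) \<in> moves M w ^^ (2 * n + m)"
proof -
  have "(config slow_a 1, config slow_a (1 + n)) \<in> moves M w ^^ (2 * n)"
    by (rule moves_run_pausing[where s' = pause_a])
      (use i length_w tape_a in \<open>auto simp: amp_eq\<close>)
  moreover have "(config slow_a (1 + n), config slow_a (1 + n + m)) \<in> moves M w ^^ m"
    by (rule moves_run) (use i length_w tape_b in \<open>auto simp: amp_eq\<close>)
  ultimately have "(config slow_a 1, config slow_a (1 + n + m)) \<in> moves M w ^^ (2 * n + m)"
    by (rule relpow_trans)
  then show ?thesis by (simp add: algebra_simps)
qed

section \<open>The branches at the right end-marker\<close>

text \<open>The sign of the \<open>differ\<close> amplitude is left open because only its modulus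
  counts for a branch arriving alone; this makes the two branches interchangeable.\<close>

definition arrives :: "nat config \<Rightarrow> bool" where
  "arrives e \<longleftrightarrow> e \<in> configs M w \<and> (\<exists>\<sigma>\<in>{half_amp, - half_amp}. evol_ket M w e =
     superpose half_amp (config same (n + m + 1)) \<sigma> (config differ (n + m + 1)))"

lemma evol_ket_arrival:
  assumes "rest = []"
  shows "evol_ket M w (config slow_b (n + m + 1)) =
      superpose half_amp (config same (n + m + 1)) half_amp (config differ (n + m + 1))"
    and "evol_ket M w (config slow_a (n + m + 1)) =
      superpose half_amp (config same (n + m + 1)) (- half_amp) (config differ (n + m + 1))"
proof -
  have end_symbol: "tape w ! nat (int (n + m + 1)) = RightEnd"
    using tape_RightEnd[of w] assms(1) by (simp add: length_w nat_add_distrib)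
  have pos: "(int (n + m + 1) + head_move s) mod int (length (tape w)) = int (n + m + 1)"
    if "s \<in> {same, differ}" for s
    using that assms by (auto simp: head_move_def length_tape length_w)
  have "evol_ket M w (13 * i + s, int (n + m + 1)) =
      superpose half_amp (config same (n + m + 1)) \<sigma> (config differ (n + m + 1))"
    if "s < 13" "\<And>u. amp RightEnd s u = half_amp * of_bool (u = same) + \<sigma> * of_bool (u = differ)" for s \<sigma>
  proof -
    have "amp (tape w ! nat (int (n + m + 1))) s u =
        half_amp * of_bool (u = same) + \<sigma> * of_bool (u = differ)" for u
      unfolding end_symbol by (rule that)
    from evol_ket_eq_machine[OF i that(1) _ _ this] show ?thesis
      using pos by simp
  qed
  from this[of slow_b half_amp] this[of slow_a "- half_amp"]
  show "evol_ket M w (config slow_b (n + m + 1)) =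
      superpose half_amp (config same (n + m + 1)) half_amp (config differ (n + m + 1))"
    and "evol_ket M w (config slow_a (n + m + 1)) =
      superpose half_amp (config same (n + m + 1)) (- half_amp) (config differ (n + m + 1))"
    by (simp_all add: amp_eq)
qed

lemma arrives_end:
  assumes "rest = []"
  shows "arrives (config slow_b (n + m + 1))" "arrives (config slow_a (n + m + 1))"
proof -
  have "config s (n + m + 1) \<in> configs M w" if "s < 13" for s
    using that i by (intro config_eq_machine) (simp_all add: length_w)
  then show "arrives (config slow_b (n + m + 1))" "arrives (config slow_a (n + m + 1))"
    unfolding arrives_def using evol_ket_arrival[OF assms] by auto
qed

lemma end_config: "s < 13 \<Longrightarrow> config s (n + m + 1) \<in> configs M w"
  using i by (intro config_eq_machine) (simp_all add: length_w)

lemma gains_differ: "gains M w (13 * i + differ) 0 1 B"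
  using i by (intro gains_mono[OF gains_reject[OF wf]]) (simp_all add: Q_eq_machine)

lemma finite_states: "finite (states M)"
  by (simp add: states_eq_machine)

text \<open>Since \<open>d'\<close> is nonhalting and \<open>same\<close> and \<open>differ\<close>
  are not, the branches do not interfere: the amplitudes on \<open>same\<close> and
  \<open>differ\<close> have modulus 1/2, hence weight 1/4 each, and the other branch continues with
  amplitude \<open>half_amp\<close>.\<close>

lemma outcome_arrival_first:
  assumes "arrives e" and d: "(d, d') \<in> moves M w"
    and out: "outcome M w (\<lambda>x. half_amp * ket d' x) a' r' B"
    and same: "gains M w (13 * i + same) a r B"
  shows "outcome M w (superpose half_amp e half_amp d) (a' + a / 4) (r' + (r + 1) / 4) (Suc B)"
proof -
  define s f where "s = config same (n + m + 1)" and "f = config differ (n + m + 1)"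
  obtain \<sigma> where e: "e \<in> configs M w" and \<sigma>: "\<sigma> \<in> {half_amp, - half_amp}"
    "evol_ket M w e = superpose half_amp s \<sigma> f"
    using assms(1) by (auto simp: arrives_def s_def f_def)
  have d': "d \<in> configs M w" "d' \<in> configs M w" "fst d' \<in> Q_non M" "evol_ket M w d = ket d'"
    using d by (auto simp: moves_def)
  have non: "fst s \<notin> Q_non M" "fst f \<notin> Q_non M"
    using i by (simp_all add: s_def f_def Q_eq_machine)
  then have dist: "s \<noteq> f" "d' \<noteq> s" "d' \<noteq> f"
    using d'(3) by (auto simp: s_def f_def)
  have conf: "s \<in> configs M w" "f \<in> configs M w"
    unfolding s_def f_def by (rule end_config; simp)+
  define \<phi> where "\<phi> = (\<lambda>x. half_amp * superpose half_amp s \<sigma> f x + half_amp * ket d' x)"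
  have evol: "evol M w (superpose half_amp e half_amp d) = \<phi>"
    using evol_superpose[OF finite_states e d'(1)] \<sigma>(2) d'(4) by (simp add: \<phi>_def)
  have \<phi>: "\<phi> s = 1 / 2" "(cmod (\<phi> f))\<^sup>2 = 1 / 4"
    using dist \<sigma>(1) by (auto simp: \<phi>_def superpose_def ket_def half_amp_sq power_divide)
  have proj: "proj (Q_non M) \<phi> = (\<lambda>x. half_amp * ket d' x)"
    using non d'(3) by (auto simp: \<phi>_def proj_def superpose_def ket_def fun_eq_iff)
  define ga gr where "ga c = (if c = s then a else 0)"
    and "gr c = (if c = s then r else if c = f then 1 else 0)" for c
  have "outcome M w (superpose half_amp e half_amp d)
      (a' + (\<Sum>c\<in>{s, f, d'}. (cmod (\<phi> c))\<^sup>2 * ga c))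
      (r' + (\<Sum>c\<in>{s, f, d'}. (cmod (\<phi> c))\<^sup>2 * gr c)) (Suc B)"
  proof (rule outcome_step[OF finite_states evol])
    show "outcome M w (proj (Q_non M) \<phi>) a' r' B" unfolding proj by (rule out)
    show "{s, f, d'} \<subseteq> configs M w" using conf d'(2) by simp
    show "\<phi> c = 0" if "c \<in> configs M w - {s, f, d'}" for c
      using that by (simp add: \<phi>_def superpose_def ket_def)
    have "gains M w (fst d') 0 0 B"
      using d'(3) by (intro gains_mono[OF gains_nonhalting[OF wf]]) simp_all
    then show "gains M w (fst c) (ga c) (gr c) B" if "c \<in> {s, f, d'}" for c
      using that dist same gains_differ unfolding ga_def gr_def by (auto simp: s_def f_def)
  qed
  moreover have "(\<Sum>c\<in>{s, f, d'}. (cmod (\<phi> c))\<^sup>2 * ga c) = a / 4"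
    "(\<Sum>c\<in>{s, f, d'}. (cmod (\<phi> c))\<^sup>2 * gr c) = (r + 1) / 4"
    using dist by (auto simp: ga_def gr_def \<phi> norm_divide power_divide)
  ultimately show ?thesis by simp
qed

lemma outcome_arrival_single:
  assumes "arrives e" and same: "gains M w (13 * i + same) a r B"
  shows "outcome M w (ket e) (a / 2) ((r + 1) / 2) (Suc B)"
proof -
  define s f where "s = config same (n + m + 1)" and "f = config differ (n + m + 1)"
  obtain \<sigma> where e: "e \<in> configs M w" and \<sigma>: "\<sigma> \<in> {half_amp, - half_amp}"
    "evol_ket M w e = superpose half_amp s \<sigma> f"
    using assms(1) by (auto simp: arrives_def s_def f_def)
  have non: "fst s \<notin> Q_non M" "fst f \<notin> Q_non M"
    using i by (simp_all add: s_def f_def Q_eq_machine)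
  have dist: "s \<noteq> f" by (auto simp: s_def f_def)
  have conf: "s \<in> configs M w" "f \<in> configs M w"
    unfolding s_def f_def by (rule end_config; simp)+
  define \<phi> where "\<phi> = superpose half_amp s \<sigma> f"
  have evol: "evol M w (ket e) = \<phi>"
    using evol_ket_configs[OF finite_states e] \<sigma>(2) by (simp add: \<phi>_def)
  have \<phi>: "(cmod (\<phi> s))\<^sup>2 = 1 / 2" "(cmod (\<phi> f))\<^sup>2 = 1 / 2"
    using dist \<sigma>(1) by (auto simp: \<phi>_def superpose_def ket_def half_amp_sq)
  have proj: "proj (Q_non M) \<phi> = (\<lambda>x. 0)"
    using non by (auto simp: \<phi>_def proj_def superpose_def ket_def fun_eq_iff)
  define ga gr where "ga c = (if c = s then a else 0)"
    and "gr c = (if c = s then r else if c = f then 1 else 0)" for c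
  have "outcome M w (ket e) (0 + (\<Sum>c\<in>{s, f}. (cmod (\<phi> c))\<^sup>2 * ga c))
      (0 + (\<Sum>c\<in>{s, f}. (cmod (\<phi> c))\<^sup>2 * gr c)) (Suc B)"
  proof (rule outcome_step[OF finite_states evol])
    show "outcome M w (proj (Q_non M) \<phi>) 0 0 B"
      unfolding proj by (rule outcome_mono[OF outcome_zero]) simp
    show "{s, f} \<subseteq> configs M w" using conf by simp
    show "\<phi> c = 0" if "c \<in> configs M w - {s, f}" for c
      using that by (simp add: \<phi>_def superpose_def ket_def)
    show "gains M w (fst c) (ga c) (gr c) B" if "c \<in> {s, f}" for c
      using that dist same gains_differ unfolding ga_def gr_def by (auto simp: s_def f_def)
  qed
  moreover have "(\<Sum>c\<in>{s, f}. (cmod (\<phi> c))\<^sup>2 * ga c) = a / 2"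
    "(\<Sum>c\<in>{s, f}. (cmod (\<phi> c))\<^sup>2 * gr c) = (r + 1) / 2"
    using dist by (auto simp: ga_def gr_def \<phi> field_simps)
  ultimately show ?thesis by simp
qed

text \<open>The early branch contributes \<open>a / 4\<close> and \<open>(r + 1) / 4\<close>; the
  late one, of weight 1/2, arrives alone and contributes the same. Its run is cut into
  \<open>t\<close> parallel steps, one step during the first measurement, and \<open>u\<close> steps
  alone.\<close>

lemma outcome_separate:
  assumes c: "(c, e) \<in> moves M w ^^ t" "arrives e" and d: "(d, e') \<in> moves M w ^^ t'" "arrives e'"
    and less: "t < t'" and same: "gains M w (13 * i + same) a r B"
  shows "outcome M w (superpose half_amp c half_amp d) (a / 2) ((r + 1) / 2) (t' + Suc B)"
proof -
  define u where "u = t' - t - 1"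
  have t': "t' = t + Suc u" using less by (simp add: u_def)
  obtain d0 d1 where d0: "(d, d0) \<in> moves M w ^^ t" "(d0, d1) \<in> moves M w" "(d1, e') \<in> moves M w ^^ u"
    using d(1) unfolding t' relpow_add by (blast elim: relpow_Suc_E2)
  have "outcome M w (ket d1) (a / 2) ((r + 1) / 2) (u + Suc B)"
    by (rule outcome_moves_ket[OF wf d0(3) outcome_arrival_single[OF d(2) same]])
  then have "outcome M w (\<lambda>x. half_amp * ket d1 x) (a / 2 / 2) ((r + 1) / 2 / 2) (u + Suc B)"
    by (rule outcome_scale)
  then have "outcome M w (superpose half_amp e half_amp d0)
      (a / 2 / 2 + a / 4) ((r + 1) / 2 / 2 + (r + 1) / 4) (Suc (u + Suc B))"
    by (rule outcome_arrival_first[OF c(2) d0(2)]) (rule gains_mono[OF same], simp)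
  from outcome_moves[OF wf c(1) d0(1) this]
  have "outcome M w (superpose half_amp c half_amp d)
    (a / 2 / 2 + a / 4) ((r + 1) / 2 / 2 + (r + 1) / 4) (t + Suc (u + Suc B))" .
  moreover have "a / 2 / 2 + a / 4 = a / 2" "(r + 1) / 2 / 2 + (r + 1) / 4 = (r + 1) / 2" by simp_all
  ultimately show ?thesis by (simp add: t' add.assoc)
qed

text \<open>The amplitudes on \<open>differ\<close> cancel and those on \<open>same\<close> add up
  to 1/2 + 1/2, so the measurement is certain.\<close>

lemma outcome_meet:
  assumes "rest = []" and same: "gains M w (13 * i + same) a r B"
  shows "outcome M w (superpose half_amp (config slow_b (n + m + 1)) half_amp (config slow_a (n + m + 1)))
    a r (Suc B)"
proof (rule outcome_halt[OF wf])
  have "evol M w (superpose half_amp (config slow_b (n + m + 1)) half_amp (config slow_a (n + m + 1)))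
    = (\<lambda>x. half_amp * (half_amp * ket (config same (n + m + 1)) x + half_amp * ket (config differ (n + m + 1)) x)
      + half_amp * (half_amp * ket (config same (n + m + 1)) x + - half_amp * ket (config differ (n + m + 1)) x))"
    by (subst evol_superpose[OF finite_states end_config end_config])
      (simp_all only: evol_ket_arrival[OF assms(1)], simp_all add: superpose_def)
  also have "\<dots> = (\<lambda>x. (half_amp * half_amp + half_amp * half_amp) * ket (config same (n + m + 1)) x)"
    by (simp add: algebra_simps)
  also have "\<dots> = ket (config same (n + m + 1))"
    by (simp add: half_amp_sq)
  finally show "evol M w (superpose half_amp (config slow_b (n + m + 1)) half_amp (config slow_a (n + m + 1)))
    = ket (config same (n + m + 1))" .
  show "config same (n + m + 1) \<in> configs M w" by (rule end_config) simp
  show "fst (config same (n + m + 1)) \<notin> Q_non M"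
    unfolding fst_conv using i by (simp add: Q_eq_machine)
  show "gains M w (fst (config same (n + m + 1))) a r B" using same by simp
qed

lemma outcome_fork:
  assumes "outcome M w (superpose half_amp (config slow_b 1) half_amp (config slow_a 1)) a r B"
  shows "outcome M w (ket (config fork 0)) a r (Suc B)"
proof (rule outcome_nonhalting[OF wf _ _ _ _ _ assms])
  have "evol_ket M w (config fork 0) = superpose half_amp (config slow_b 1) half_amp (config slow_a 1)"
    using evol_ket_eq_machine[of i k fork slow_b slow_a w 0 half_amp half_amp] i
    by (simp add: tape_LeftEnd amp_eq head_move_def length_tape)
  then show "evol M w (ket (config fork 0)) = superpose half_amp (config slow_b 1) half_amp (config slow_a 1)"
    using evol_ket_configs[OF finite_states config_eq_machine[OF i, of fork 0 w]] by simp
  show "config slow_b 1 \<in> configs M w" "config slow_a 1 \<in> configs M w"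
    using config_eq_machine[OF i, of slow_b 1 w] config_eq_machine[OF i, of slow_a 1 w] by simp_all
  show "fst (config slow_b 1) \<in> Q_non M" "fst (config slow_a 1) \<in> Q_non M"
    unfolding fst_conv using i by (simp_all add: Q_eq_machine)
qed

text \<open>The bound allows \<open>length w + 4\<close> steps for the scan with its reset, one for
  the fork, \<open>2 * length w\<close> for the branches and one for the interference.\<close>

lemma outcome_round_equal:
  assumes "rest = []" "n = m" and same: "gains M w (13 * i + same) a r B"
  shows "outcome M w (ket (config scan_a 0)) a r (B + (3 * length w + 6))"
proof -
  have len: "2 * n + m = n + 2 * m" using assms(2) by simp
  have "outcome M w (superpose half_amp (config slow_b 1) half_amp (config slow_a 1)) a r (n + 2 * m + Suc B)"
    by (rule outcome_moves[OF wf slow_b_run[OF assms(1)] slow_a_run[OF assms(1), unfolded len]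
      outcome_meet[OF assms(1) same]])
  from outcome_scan_ok[OF assms(1) outcome_fork[OF this]] show ?thesis
    by (rule outcome_mono) (simp add: length_w)
qed

lemma outcome_round_unequal:
  assumes "rest = []" "n \<noteq> m" and same: "gains M w (13 * i + same) a r B"
  shows "outcome M w (ket (config scan_a 0)) (a / 2) ((r + 1) / 2) (B + (3 * length w + 6))"
proof -
  note b = slow_b_run[OF assms(1)] arrives_end(1)[OF assms(1)]
  note a = slow_a_run[OF assms(1)] arrives_end(2)[OF assms(1)]
  have "outcome M w (superpose half_amp (config slow_b 1) half_amp (config slow_a 1)) (a / 2) ((r + 1) / 2)
    (2 * (n + m) + Suc B)"
  proof (cases "n < m")
    case True
    \<comment> \<open>Here \<open>2 * n + m < n + 2 * m\<close>, so \<open>slow_a\<close> arrives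
      first and the branches exchange roles.\<close>
    then have "outcome M w (superpose half_amp (config slow_a 1) half_amp (config slow_b 1)) (a / 2) ((r + 1) / 2)
      (n + 2 * m + Suc B)"
      by (intro outcome_separate[OF a b _ same]) simp
    then show ?thesis
      unfolding superpose_commute[of _ "config slow_a 1"] by (rule outcome_mono) simp
  next
    case False
    then have "outcome M w (superpose half_amp (config slow_b 1) half_amp (config slow_a 1)) (a / 2) ((r + 1) / 2)
      (2 * n + m + Suc B)"
      using assms(2) by (intro outcome_separate[OF b a _ same]) simp
    then show ?thesis by (rule outcome_mono) simp
  qed
  from outcome_scan_ok[OF assms(1) outcome_fork[OF this]] show ?thesis
    by (rule outcome_mono) (simp add: length_w)
qed

end

section \<open>All rounds\<close>

text \<open>The blocks are taken maximal. A nonempty \<open>rest\<close> then begins with a, and the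
  b's before it cannot be missing, since otherwise this a would belong to the first block.\<close>

lemma word_decomposition:
  obtains n m rest where "w = replicate n La @ replicate m Lb @ rest"
    and "rest = [] \<or> m > 0 \<and> (\<exists>rest'. rest = La # rest')"
proof -
  define as v where "as = takeWhile (\<lambda>x. x = La) w" and "v = dropWhile (\<lambda>x. x = La) w"
  define bs rest where "bs = takeWhile (\<lambda>x. x = Lb) v" and "rest = dropWhile (\<lambda>x. x = Lb) v"
  have "as = replicate (length as) La" "bs = replicate (length bs) Lb"
    by (rule replicate_length_same[symmetric], auto simp: as_def bs_def dest: set_takeWhileD)+
  moreover have "w = as @ bs @ rest"
    by (simp add: as_def v_def bs_def rest_def)
  moreover have "rest = [] \<or> length bs > 0 \<and> (\<exists>rest'. rest = La # rest')"
  proof (cases rest)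
    case (Cons x rest')
    have "x \<noteq> Lb" using Cons unfolding rest_def dropWhile_eq_Cons_conv by simp
    then have x: "x = La" by (cases x) auto
    have "length bs > 0"
    proof (rule ccontr)
      assume "\<not> length bs > 0"
      then have "v = La # rest'"
        using Cons x takeWhile_dropWhile_id[of "\<lambda>x. x = Lb" v] by (simp add: bs_def rest_def)
      then show False unfolding v_def dropWhile_eq_Cons_conv by simp
    qed
    then show ?thesis using Cons x by simp
  qed simp
  ultimately show thesis using that[of "length as" "length bs" rest] by metis
qed

text \<open>A nonempty \<open>rest\<close> puts an a after a b, so deleting the leading a's on both
  sides would leave an a in a word of b's. Otherwise counting each letter gives
  \<open>n = m\<close>.\<close>

lemma L_eq_iff:
  assumes "rest = [] \<or> m > 0 \<and> (\<exists>rest'. rest = La # rest')"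
  shows "replicate n La @ replicate m Lb @ rest \<in> L_eq \<longleftrightarrow> rest = [] \<and> n = m"
proof
  assume "replicate n La @ replicate m Lb @ rest \<in> L_eq"
  then obtain l where l: "replicate n La @ replicate m Lb @ rest = replicate l La @ replicate l Lb"
    by (auto simp: L_eq_def)
  have rest: "rest = []"
  proof (rule ccontr)
    assume "rest \<noteq> []"
    then obtain rest' where "m > 0" "rest = La # rest'" using assms by auto
    then obtain m' where "replicate n La @ Lb # replicate m' Lb @ La # rest' = replicate l La @ replicate l Lb"
      using l by (cases m) auto
    then have "dropWhile (\<lambda>x. x = La) (replicate n La @ Lb # replicate m' Lb @ La # rest') =
       dropWhile (\<lambda>x. x = La) (replicate l La @ replicate l Lb)" by simp
    then have "Lb # replicate m' Lb @ La # rest' = replicate l Lb"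
      by (cases l) (simp_all add: dropWhile_append)
    then have "La \<in> set (replicate l Lb)" by (metis in_set_conv_decomp append_Cons)
    then show False by simp
  qed
  have "length (filter ((=) x) (replicate n La @ replicate m Lb)) =
      length (filter ((=) x) (replicate l La @ replicate l Lb))" for x
    using l rest by simp
  from this[of La] this[of Lb] show "rest = [] \<and> n = m" using rest by simp
next
  assume "rest = [] \<and> n = m"
  then show "replicate n La @ replicate m Lb @ rest \<in> L_eq" by (auto simp: L_eq_def)
qed

text \<open>Backward induction over the copies: the value of \<open>same\<close> in copy
  \<open>i\<close> is that of starting copy \<open>i + 1\<close>. \<open>R d\<close> constrains the
  pair of probabilities when \<open>d\<close> rounds remain, and \<open>R 0 1 0\<close> stands for
  the accepting \<open>same\<close>.\<close>

lemma outcome_rounds: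
  assumes R0: "R 0 1 0"
    and step: "\<And>d i a r B. i < k \<Longrightarrow> R d a r \<Longrightarrow> gains (eq_machine k) w (13 * i + same) a r B \<Longrightarrow>
      \<exists>a' r'. R (Suc d) a' r' \<and> outcome (eq_machine k) w (ket (13 * i + scan_a, 0)) a' r' (B + T)"
    and "d < k"
  shows "\<exists>a r. R (Suc d) a r \<and>
    outcome (eq_machine k) w (ket (13 * (k - Suc d) + scan_a, 0)) a r (Suc d * T)"
  using \<open>d < k\<close>
proof (induction d)
  case 0
  have wf: "qfa_reset_wf (eq_machine k)" using 0 by (intro qfa_reset_wf_eq_machine) simp
  have "gains (eq_machine k) w (13 * (k - 1) + same) 1 0 0"
    using 0 by (intro gains_accept[OF wf]) (simp add: Q_eq_machine)
  from step[OF _ R0 this] 0 show ?case by simp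
next
  case (Suc d)
  have wf: "qfa_reset_wf (eq_machine k)" using Suc.prems by (intro qfa_reset_wf_eq_machine) simp
  define i where "i = k - Suc (Suc d)"
  have i: "i < k" "Suc i < k" "k - Suc d = Suc i" using Suc.prems by (auto simp: i_def)
  obtain a r where R: "R (Suc d) a r"
    and out: "outcome (eq_machine k) w (ket (13 * Suc i + scan_a, 0)) a r (Suc d * T)"
    using Suc i by auto
  have "13 * Suc i + scan_a \<in> Q_non (eq_machine k)"
    by (subst Q_eq_machine(1)[OF i(2)]) simp_all
  moreover have "13 * i + same \<in> Q_reset (eq_machine k) (13 * Suc i + scan_a)"
    by (subst Q_eq_machine(4)[OF i(1)]) simp_all
  ultimately have "gains (eq_machine k) w (13 * i + same) a r (Suc d * T)"
    using out by (rule gains_reset[OF wf])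
  from step[OF i(1) R this] show ?case by (simp add: i_def add.commute)
qed

lemma outcome_accept_reject:
  assumes "outcome M w (ket (init M, 0)) a r B"
  shows "accept_prob M w = a" "reject_prob M w = r" "a + r = 1 \<Longrightarrow> halts_within M w B"
proof -
  have "accept_within M w n = a" "reject_within M w n = r" if "n \<ge> B" for n
    using assms that by (auto simp: outcome_def accept_within_def reject_within_def)
  moreover from this have "accept_within M w \<longlonglongrightarrow> a" "reject_within M w \<longlonglongrightarrow> r"
    by (auto intro!: tendsto_eventually eventually_sequentiallyI[of B])
  ultimately show "accept_prob M w = a" "reject_prob M w = r" "a + r = 1 \<Longrightarrow> halts_within M w B"
    by (auto simp: accept_prob_def reject_prob_def halts_within_def intro: limI)
qed

lemma outcome_eq_machine:
  assumes "k > 0"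
  shows "\<exists>a r. outcome (eq_machine k) w (ket (init (eq_machine k), 0)) a r (k * (3 * length w + 6)) \<and> a + r = 1 \<and>
    (if w \<in> L_eq then a = 1 else a \<le> (1 / 2) ^ k)"
proof -
  obtain n m rest where w: "w = replicate n La @ replicate m Lb @ rest"
    and rest: "rest = [] \<or> m > 0 \<and> (\<exists>rest'. rest = La # rest')"
    using word_decomposition[of w] by blast
  have loc: "ab_word k i n m w rest" if "i < k" for i
    using that w by unfold_locales
  have L_eq: "w \<in> L_eq \<longleftrightarrow> rest = [] \<and> n = m"
    unfolding w by (rule L_eq_iff[OF rest])
  \<comment> \<open>The inequality covers both kinds of nonmembers: with the wrong shape the scan
    rejects and \<open>a\<close> is 0, with the right shape each round halves
    \<open>a\<close>.\<close>
  define R :: "nat \<Rightarrow> real \<Rightarrow> real \<Rightarrow> bool" where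
    "R d a r \<longleftrightarrow> a + r = 1 \<and> (if w \<in> L_eq then a = 1 else a \<le> (1 / 2) ^ d)" for d a r
  \<comment> \<open>With \<open>k - 1\<close> for \<open>d\<close> the starting copy is 0, so this
    is the full chain of \<open>k\<close> rounds from \<open>init\<close>.\<close>
  have "\<exists>a r. R (Suc (k - 1)) a r \<and>
    outcome (eq_machine k) w (ket (13 * (k - Suc (k - 1)) + scan_a, 0)) a r (Suc (k - 1) * (3 * length w + 6))"
  proof (rule outcome_rounds)
    show "R 0 1 0" by (simp add: R_def)
    fix d i a r B
    assume i: "i < k" and R: "R d a r" and same: "gains (eq_machine k) w (13 * i + same) a r B"
    interpret ab_word k i n m w rest by (rule loc[OF i])
    consider "rest = []" "n = m" | "rest = []" "n \<noteq> m" | rest' where "rest = La # rest'" "m > 0"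
      using rest by blast
    then show "\<exists>a' r'. R (Suc d) a' r' \<and>
        outcome (eq_machine k) w (ket (13 * i + scan_a, 0)) a' r' (B + (3 * length w + 6))"
    proof cases
      case 1
      then have "R (Suc d) a r" using R L_eq by (simp add: R_def)
      then show ?thesis using outcome_round_equal[OF 1 same] by auto
    next
      case 2
      then have "R (Suc d) (a / 2) ((r + 1) / 2)" using R L_eq by (simp add: R_def field_simps)
      then show ?thesis using outcome_round_unequal[OF 2 same] by auto
    next
      case 3
      then have "R (Suc d) 0 1" using L_eq by (simp add: R_def)
      moreover have "outcome (eq_machine k) w (ket (13 * i + scan_a, 0)) 0 1 (B + (3 * length w + 6))"
        using outcome_mono[OF outcome_scan_bad[OF 3], of "B + (3 * length w + 6)"] by simp
      ultimately show ?thesis by blast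
    qed
  qed (use assms in simp)
  moreover have "13 * (k - Suc (k - 1)) + scan_a = init (eq_machine k)" "Suc (k - 1) = k"
    using assms by (simp_all add: eq_machine_def)
  ultimately show ?thesis unfolding R_def by metis
qed

theorem theorem21:
  "\<exists>C :: real. C > 0 \<and>
     (\<forall>\<epsilon> :: real. 0 < \<epsilon> \<and> \<epsilon> < 1 / 2 \<longrightarrow>
       (\<exists>M :: nat qfa_reset.
          qfa_reset_wf M \<and>
          real (card (states M)) \<le> C * ln (1 / \<epsilon>) \<and>
          recognizes_one_sided M L_eq \<epsilon> \<and>
          (\<forall>w. \<exists>t :: nat. real t \<le> C * ln (1 / \<epsilon>) * real (max 1 (length w)) \<and>
                 halts_within M w t)))"
proof (intro exI[of _ "26 / ln 2"] conjI allI impI)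
  show "26 / ln 2 > (0 :: real)" by simp
next
  fix \<epsilon> :: real
  assume \<epsilon>: "0 < \<epsilon> \<and> \<epsilon> < 1 / 2"
  \<comment> \<open>\<open>l\<close> is the binary logarithm of 1/\<epsilon>. It exceeds 1 because
    \<epsilon> < 1/2, so rounding up at most doubles it; the \<open>13 * k\<close> states are then
    at most \<open>26 * l\<close>, whence the constant \<open>26 / ln 2\<close>.\<close>
  define l where "l = ln (1 / \<epsilon>) / ln 2"
  define k where "k = nat \<lceil>l\<rceil>"
  have "ln 2 < ln (1 / \<epsilon>)" using \<epsilon> by (subst ln_less_cancel_iff) (auto simp: field_simps)
  then have l: "l > 1" by (simp add: l_def)
  have k: "real k \<ge> l" "real k \<le> 2 * l" "k > 0"
    using l by (auto simp: k_def) linarith+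
  have "(1 / 2) ^ k \<le> \<epsilon>"
  proof -
    have "ln (1 / \<epsilon>) \<le> real k * ln 2" using k(1) by (simp add: l_def field_simps)
    also have "\<dots> = ln (2 ^ k)" by (simp add: ln_realpow)
    finally have "1 / \<epsilon> \<le> 2 ^ k" using \<epsilon> by (subst (asm) ln_le_cancel_iff) auto
    then show ?thesis using \<epsilon> by (simp add: field_simps power_divide)
  qed
  note out = outcome_eq_machine[OF k(3)]
  have "recognizes_one_sided (eq_machine k) L_eq \<epsilon>"
    unfolding recognizes_one_sided_def
  proof (intro disjI1 conjI ballI allI impI)
    fix w assume "w \<in> L_eq"
    then show "accept_prob (eq_machine k) w = 1"
      using out[of w] outcome_accept_reject(1)[of "eq_machine k" w] by auto
  next
    fix w assume "w \<notin> L_eq"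
    then obtain a r where "outcome (eq_machine k) w (ket (init (eq_machine k), 0)) a r (k * (3 * length w + 6))"
      "a + r = 1" "a \<le> (1 / 2) ^ k"
      using out[of w] by auto
    then show "reject_prob (eq_machine k) w \<ge> 1 - \<epsilon>"
      using outcome_accept_reject(2)[of "eq_machine k" w a r] \<open>(1 / 2) ^ k \<le> \<epsilon>\<close> by auto
  qed
  moreover have "\<exists>t :: nat. real t \<le> 26 / ln 2 * ln (1 / \<epsilon>) * real (max 1 (length w)) \<and>
      halts_within (eq_machine k) w t" for w
  proof (intro exI conjI)
    show "halts_within (eq_machine k) w (k * (3 * length w + 6))"
      using out[of w] outcome_accept_reject(3)[of "eq_machine k" w] by auto
    \<comment> \<open>The maximum absorbs the empty word; the factor 9 = 3 + 6 is then relaxed to 13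
      to share the constant of the state count.\<close>
    have "real (k * (3 * length w + 6)) \<le> real k * (9 * real (max 1 (length w)))"
      by (simp only: of_nat_mult) (intro mult_left_mono; simp)
    also have "\<dots> \<le> (2 * l) * (13 * real (max 1 (length w)))"
      using k(2) l by (intro mult_mono) auto
    finally show "real (k * (3 * length w + 6)) \<le> 26 / ln 2 * ln (1 / \<epsilon>) * real (max 1 (length w))"
      by (simp add: l_def)
  qed
  moreover have "real (card (states (eq_machine k))) \<le> 26 / ln 2 * ln (1 / \<epsilon>)"
    using k(2) by (simp add: states_eq_machine l_def)
  ultimately show "\<exists>M :: nat qfa_reset. qfa_reset_wf M \<and>
          real (card (states M)) \<le> 26 / ln 2 * ln (1 / \<epsilon>) \<and>
          recognizes_one_sided M L_eq \<epsilon> \<and>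
          (\<forall>w. \<exists>t :: nat. real t \<le> 26 / ln 2 * ln (1 / \<epsilon>) * real (max 1 (length w)) \<and>
                 halts_within M w t)"
    using qfa_reset_wf_eq_machine[OF k(3)] by blast
qed

end
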